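(* Let $0\le\alpha\le 2$, $0<t<\pi/2$, let $D$ be a symmetric circular quadrilateral with interior angle $\alpha\pi$ at each vertex, and let $f:\mathbb{D}\to D$ be a conformal mapping with $f(0)=0$, $f'(0)>0$ taking $\pm e^{\pm it}$ to the vertices of $D$. Let $\lambda\in\mathbb{R}$ be the parameter for which the Schwarzian derivative of $f$ is $$\mathcal{S}_f(z)=4(1-\alpha^2)\,\frac{(\cos 2t)z^4-2z^2+\cos 2t}{(z^4-2(\cos 2t)z^2+1)^2}-2\lambda\,\frac{2\sin 2t}{z^4-2(\cos 2t)z^2+1}.$$ Let $E$, $R=E(\mathbb{D})$, $\omega_1,\omega_2,\omega_3$ and $\wp$ be as in the context, and let $g=f\circ E^{-1}:R\to D$. Then there is a constant $\mu\in\mathbb{R}$ such that $$\mathcal{S}_g(\zeta)=\frac{1-4\alpha^2}{2}\,\wp(\zeta+\omega_3)-2\mu\qquad(\zeta\in R),$$ and $$\mu=\frac{2(\alpha^2-1)}{3}\cos 2t+2\lambda\sin 2t .$$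
   Context: $\mathbb{D}$ is the open unit disk. A symmetric circular quadrilateral is a domain $D\subset\mathbb{C}$ bounded by a Jordan curve formed by joining four vertices $v,\overline v,-v,-\overline v$ by circular arcs, with common interior angle $\alpha\pi$ at each vertex, and symmetric in the real and imaginary axes. The Schwarzian derivative is $\mathcal{S}_f=(f''/f')'-\frac12(f''/f')^2$. It is a classical fact that $\mathcal{S}_f$ has the displayed form for some real $\lambda$. $E(z)=\int_0^z \frac{du}{\sqrt{u^4-2(\cos 2t)u^2+1}}$ for $z\in\mathbb{D}$, with the branch of the square root equal to $1$ at $0$; $\omega_1=E(1)>0$, $\omega_2=E(i)\in i\mathbb{R}$ (integrals along straight segments), $\omega_3=\omega_1+\omega_2$; $E$ maps $\mathbb{D}$ conformally onto the rectangle $R=\{w: |\operatorname{Re} w|<\omega_1,\ |\operatorname{Im} w|<|\omega_2|\}$. $\wp$ is the Weierstrass $\wp$-function with primitive periods $2\omega_1,2\omega_2$. *)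

theory Defs
  imports "HOL-Complex_Analysis.Complex_Analysis"
begin

definition schwarzian :: "(complex \<Rightarrow> complex) \<Rightarrow> complex \<Rightarrow> complex" where
  "schwarzian f z =
     deriv (\<lambda>w. deriv (deriv f) w / deriv f w) z
       - 1 / 2 * (deriv (deriv f) z / deriv f z) ^ 2"

definition conformal_onto :: "(complex \<Rightarrow> complex) \<Rightarrow> complex set \<Rightarrow> complex set \<Rightarrow> bool" where
  "conformal_onto f S T \<longleftrightarrow> f holomorphic_on S \<and> inj_on f S \<and> f ` S = T"


text \<open>Straight segments count as arcs of generalized circles, so that for instance
  rectangles are circular quadrilaterals.\<close>

definition circular_arc :: "(real \<Rightarrow> complex) \<Rightarrow> bool" where
  "circular_arc g \<longleftrightarrow>
     (\<exists>a b. a \<noteq> b \<and> g = linepath a b) \<or>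
     (\<exists>c r s s'. 0 < r \<and> s \<noteq> s' \<and> \<bar>s' - s\<bar> < 2 * pi \<and> g = part_circlepath c r s s')"

text \<open>The domain \<open>D\<close> has interior angle \<open>A\<close> (in radians, between \<open>0\<close> and \<open>2 * pi\<close>) at its
  boundary point \<open>p\<close> if near \<open>p\<close> it is asymptotic to a sector of opening \<open>A\<close>. Referring
  to \<open>D\<close>, and not only to the tangents of the two boundary arcs meeting at \<open>p\<close>, is what
  separates the two kinds of cusps \<open>A = 0\<close> and \<open>A = 2 * pi\<close>.\<close>

definition has_interior_angle :: "complex set \<Rightarrow> complex \<Rightarrow> real \<Rightarrow> bool" where
  "has_interior_angle D p A \<longleftrightarrow>
     (\<exists>\<theta>. \<forall>\<epsilon>>0. \<exists>\<delta>>0. \<forall>\<rho> \<phi>. 0 < \<rho> \<and> \<rho> < \<delta> \<longrightarrow>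
        (\<theta> + \<epsilon> < \<phi> \<and> \<phi> < \<theta> + A - \<epsilon> \<longrightarrow> p + of_real \<rho> * cis \<phi> \<in> D) \<and>
        (\<theta> + A + \<epsilon> < \<phi> \<and> \<phi> < \<theta> + 2 * pi - \<epsilon> \<longrightarrow> p + of_real \<rho> * cis \<phi> \<notin> D))"

definition quad_vertices :: "complex \<Rightarrow> complex set" where
  "quad_vertices v = {v, cnj v, - v, - cnj v}"

text \<open>The vertices are marked boundary points (for interior angle \<open>pi\<close> they need not be visible
  in \<open>D\<close>), hence the parameter \<open>v\<close>.\<close>

definition symmetric_circular_quadrilateral :: "complex set \<Rightarrow> complex \<Rightarrow> real \<Rightarrow> bool" where
  "symmetric_circular_quadrilateral D v \<alpha> \<longleftrightarrow>
     (\<exists>g1 g2 g3 g4.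
        circular_arc g1 \<and> pathstart g1 = v \<and> pathfinish g1 = cnj v \<and>
        circular_arc g2 \<and> pathstart g2 = cnj v \<and> pathfinish g2 = - v \<and>
        circular_arc g3 \<and> pathstart g3 = - v \<and> pathfinish g3 = - cnj v \<and>
        circular_arc g4 \<and> pathstart g4 = - cnj v \<and> pathfinish g4 = v \<and>
        simple_path (g1 +++ g2 +++ g3 +++ g4) \<and>
        D = inside (path_image (g1 +++ g2 +++ g3 +++ g4))) \<and>
     (\<forall>p\<in>quad_vertices v. has_interior_angle D p (\<alpha> * pi)) \<and>
     cnj ` D = D \<and> (\<lambda>z. - cnj z) ` D = D"


text \<open>For a map of the unit disk that extends continuously to the closed disk (as conformal
  maps onto Jordan domains do), the extension maps the set \<open>A\<close> onto \<open>B\<close>.\<close>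

definition boundary_maps_onto :: "(complex \<Rightarrow> complex) \<Rightarrow> complex set \<Rightarrow> complex set \<Rightarrow> bool" where
  "boundary_maps_onto f A B \<longleftrightarrow>
     (\<exists>F. continuous_on (cball 0 1) F \<and> (\<forall>z\<in>ball 0 1. F z = f z) \<and> F ` A = B)"

definition prevertices :: "real \<Rightarrow> complex set" where
  "prevertices t = {cis t, cis (- t), - cis t, - cis (- t)}"


definition quartic :: "real \<Rightarrow> complex \<Rightarrow> complex" where
  "quartic t u = u ^ 4 - 2 * of_real (cos (2 * t)) * u ^ 2 + 1"

lemma quartic_notin_nonpos_Reals:
  assumes "u \<in> ball 0 1"
  shows "quartic t u \<notin> \<real>\<^sub>\<le>\<^sub>0"
proof
  assume *: "quartic t u \<in> \<real>\<^sub>\<le>\<^sub>0"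
  define a b where "a = 1 - u ^ 2 * cis (2 * t)" and "b = 1 - u ^ 2 * cis (- (2 * t))"
  have c: "cis (2 * t) + cis (- (2 * t)) = 2 * of_real (cos (2 * t))"
    by (simp add: complex_eq_iff)
  have "a * b = 1 - u ^ 2 * (cis (2 * t) + cis (- (2 * t)))
                  + u ^ 4 * (cis (2 * t) * cis (- (2 * t)))"
    by (simp add: a_def b_def algebra_simps power4_eq_xxxx power2_eq_square)
  hence ab: "a * b = quartic t u"
    by (simp only: c cis_mult) (simp add: quartic_def algebra_simps)
  have "norm u ^ 2 < 1"
    using assms by (simp add: power_less_one_iff)
  hence "Re (u ^ 2 * cis s) < 1" for s
    by (intro le_less_trans[OF complex_Re_le_cmod]) (simp add: norm_mult norm_power)
  hence re: "Re a > 0" "Re b > 0"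
    by (simp_all only: a_def b_def minus_complex.sel one_complex.sel diff_gt_0_iff_gt)
  from * ab have im: "Im (a * b) = 0" and le: "Re (a * b) \<le> 0"
    by (auto simp: complex_nonpos_Reals_iff)
  have "Re a * Im b = - (Im a * Re b)" using im by (simp add: algebra_simps)
  hence "Re a * Re (a * b) = Re b * ((Re a)\<^sup>2 + (Im a)\<^sup>2)"
    by (simp add: algebra_simps power2_eq_square)
  also have "\<dots> > 0"
    using re by (intro mult_pos_pos add_pos_nonneg) auto
  finally have "0 < Re a * Re (a * b)" .
  moreover have "Re a * Re (a * b) \<le> 0"
    using re le by (intro mult_nonneg_nonpos) auto
  ultimately show False by linarith
qed

text \<open>So on the unit disk the principal square root of the quartic is the holomorphic branch with
  value \<open>1\<close> at \<open>0\<close>.\<close>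

lemma csqrt_quartic_branch:
  "(\<lambda>u. csqrt (quartic t u)) holomorphic_on ball 0 1"
  "csqrt (quartic t u) ^ 2 = quartic t u"
  "csqrt (quartic t 0) = 1"
  using quartic_notin_nonpos_Reals
  by (auto intro!: holomorphic_on_csqrt' holomorphic_intros simp: quartic_def)

definition elliptic_E :: "real \<Rightarrow> complex \<Rightarrow> complex" where
  "elliptic_E t z = contour_integral (linepath 0 z) (\<lambda>u. 1 / csqrt (quartic t u))"

definition omega1 :: "real \<Rightarrow> complex" where "omega1 t = elliptic_E t 1"
definition omega2 :: "real \<Rightarrow> complex" where "omega2 t = elliptic_E t \<i>"
definition omega3 :: "real \<Rightarrow> complex" where "omega3 t = omega1 t + omega2 t"

definition rect_R :: "real \<Rightarrow> complex set" where
  "rect_R t = elliptic_E t ` ball 0 1"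


definition period_lattice :: "complex \<Rightarrow> complex \<Rightarrow> complex set" where
  "period_lattice p q = {of_int m * p + of_int n * q | m n. True}"

definition weierstrass_p :: "complex \<Rightarrow> complex \<Rightarrow> complex \<Rightarrow> complex" where
  "weierstrass_p p q z =
     1 / z ^ 2 + (\<Sum>\<^sub>\<infinity>\<omega>\<in>period_lattice p q - {0}. 1 / (z - \<omega>) ^ 2 - 1 / \<omega> ^ 2)"

end

(*
  In the coordinate zeta = E z the Schwarzian of g is (S_f - S_E) * Q, where E' = Q^(-1/2), so
  everything reduces to the identity  P(E z + omega3) = 4c/3 - 4 s^2 z^2 / Q z  on the disk, with
  c = cos 2t and s = sin 2t. E maps the four boundary arcs into the sides of a rectangle, on which
  P(. + omega3) is real, and z^2 / Q z is real on the circle as well. Near a corner p we have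
  E z - E p ~ 2 sqrt(Q z) / Q'(p), so the double pole of P matches the simple pole of 1 / Q. Hence
  (P(E z + omega3) - P(omega3)) * Q z / z^2 extends continuously to the closed disk and is real on
  the circle, so it is the constant -4 s^2. The value P(omega3) is forced by
  P'^2 - 4 P^3 = o(P^2) at the pole.
*)

theory Submission imports Defs begin

subsection \<open>The Weierstrass function of a lattice\<close>

text \<open>Put y = z^2 / Q. After reduction modulo Q, the Schwarzian side is affine in y, because
  Q'^2 = 16 z^2 (Q - s^2) and the numerator of S_f equals c Q - 2 s^2 z^2. The coefficient of y then
  fixes the factor of P, and mu collects the constants, so the exact value P(omega3) matters. The
  weight Q / z^2 is dictated by three facts: F - F 0 is even and so has a double zero at 0, the
  palindromic Q makes Q / z^2 real on the circle, and with z^2 in the denominator all four corners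
  give the same limit. The obstacle is the boundary. The integrand of E is unbounded at the corners,
  so neither continuity of E on the closed disk nor the corner asymptotics is immediate. Both follow
  from splitting E into a Lipschitz part and an explicit multiple of sqrt Q. On the side of P, the
  series converges only with the terms 1 / w^2 subtracted, which hides periodicity; it is recovered
  from summation along rows.\<close>

text \<open>The exponent is half of the 3 in \<open>1 / norm w ^ 3\<close>: with the decay shared
  evenly between the two lattice coordinates, each keeps 3/2 > 1 and the double sum factors.\<close>

lemma summable_on_int_weight: "(\<lambda>m::int. (1 + real_of_int \<bar>m\<bar>) powr (-3/2)) summable_on UNIV"
proof -
  have nat: "(\<lambda>n::nat. (1 + real n) powr (-3/2)) summable_on UNIV"
  proof -
    have "summable (\<lambda>n. real n powr (-3/2))"
      by (subst summable_real_powr_iff) auto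
    hence "summable (\<lambda>n. real (Suc n) powr (-3/2))"
      by (subst summable_Suc_iff)
    thus ?thesis
      by (subst summable_on_UNIV_nonneg_real_iff) (auto simp: add_ac)
  qed
  have 1: "(\<lambda>m::int. (1 + real_of_int \<bar>m\<bar>) powr (-3/2)) summable_on range int"
    using nat by (subst summable_on_reindex) (auto simp: o_def)
  have 2: "(\<lambda>m::int. (1 + real_of_int \<bar>m\<bar>) powr (-3/2)) summable_on range (\<lambda>n. - int n)"
    using nat by (subst summable_on_reindex) (auto simp: o_def inj_on_def)
  have "UNIV = range int \<union> range (\<lambda>n. - int n)"
    by (auto simp: image_iff) (metis int_cases2)
  with summable_on_union[OF 1 2] show ?thesis by simp
qed

lemma has_sum_diff:
  fixes f g :: "'a \<Rightarrow> complex"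
  assumes "f summable_on A" "g summable_on A"
  shows "((\<lambda>x. f x - g x) has_sum (infsum f A - infsum g A)) A"
proof -
  have "((\<lambda>x. - g x) has_sum - infsum g A) A"
    using assms(2) by (simp add: has_sum_uminus has_sum_infsum)
  from has_sum_add[OF has_sum_infsum[OF assms(1)] this] show ?thesis by simp
qed

text \<open>An unordered sum over all integers is invariant under the shift, so no boundary terms
  arise.\<close>

lemma infsum_int_telescope:
  fixes a :: "int \<Rightarrow> complex"
  assumes "a summable_on UNIV"
  shows "(\<Sum>\<^sub>\<infinity>m. a (m - 1) - a m) = 0"
proof -
  have bij: "bij_betw (\<lambda>m::int. m - 1) UNIV UNIV"
    by (rule bij_betwI[where g = "\<lambda>m. m + 1"]) auto
  have s: "(\<lambda>m. a (m - 1)) summable_on UNIV"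
    using assms summable_on_reindex_bij_betw[OF bij, of a] by simp
  show ?thesis
    using infsumI[OF has_sum_diff[OF s assms]] infsum_reindex_bij_betw[OF bij, of a] by simp
qed

lemma period_lattice_commute: "period_lattice p q = period_lattice q p"
  unfolding period_lattice_def by (metis add.commute)

lemma weierstrass_p_commute: "weierstrass_p p q = weierstrass_p q p"
  unfolding weierstrass_p_def by (subst period_lattice_commute) (rule refl)

text \<open>Subtracting \<open>1 / w^2\<close> gains one order of decay in \<open>w\<close>. The 10
  is 5/2, from the factor \<open>2 * w - z\<close>, times 4, from
  \<open>norm (z - w) \<ge> norm w / 2\<close>.\<close>

lemma norm_lattice_term_le:
  fixes z w :: complex
  assumes "w \<noteq> 0" "2 * norm z \<le> norm w"
  shows "norm (1 / (z - w)^2 - 1 / w^2) \<le> 10 * norm z / norm w ^ 3"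
proof -
  have nz: "z - w \<noteq> 0" using assms by auto
  have eq: "1 / (z - w)^2 - 1 / w^2 = z * (2 * w - z) / (w^2 * (z - w)^2)"
    using assms nz by (simp add: divide_simps) algebra
  have w: "norm w > 0" using assms by simp
  have 1: "norm (2 * w - z) \<le> 5/2 * norm w"
    using norm_triangle_ineq4[of "2*w" z] assms by (simp add: norm_mult)
  have 2: "norm (z - w) \<ge> norm w / 2"
    using norm_triangle_ineq2[of w z] assms by (simp add: norm_minus_commute)
  have "norm (1 / (z - w)^2 - 1 / w^2) = norm z * norm (2*w-z) / (norm w^2 * norm (z - w)^2)"
    unfolding eq by (simp add: norm_mult norm_divide norm_power)
  also have "\<dots> \<le> norm z * (5/2 * norm w) / (norm w^2 * (norm w / 2)^2)"
    using 1 2 w nz by (intro frac_le mult_mono mult_nonneg_nonneg power_mono mult_pos_pos) auto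
  also have "\<dots> = 10 * norm z / norm w ^ 3"
    using w by (simp add: divide_simps power2_eq_square power3_eq_cube)
  finally show ?thesis .
qed

section \<open>Plane lattices and the convergence of their sums\<close>

text \<open>\<open>Im (cnj p * q)\<close> is the signed area of the period parallelogram; its
  nonvanishing is linear independence over the reals, with either orientation allowed.\<close>

locale lattice_basis =
  fixes p q :: complex
  assumes indep: "Im (cnj p * q) \<noteq> 0"
begin

abbreviation "\<Lambda> \<equiv> period_lattice p q"

definition lattice_point :: "int \<times> int \<Rightarrow> complex" where
  "lattice_point mn = of_int (fst mn) * p + of_int (snd mn) * q"

definition regular_part :: "complex \<Rightarrow> complex" where
  "regular_part z = (\<Sum>\<^sub>\<infinity>w\<in>\<Lambda> - {0}. 1 / (z - w)^2 - 1 / w^2)"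

lemma weierstrass_p_eq: "weierstrass_p p q z = 1 / z^2 + regular_part z"
  by (simp add: weierstrass_p_def regular_part_def)

text \<open>Cramer's rule: pairing a lattice vector with \<open>cnj p\<close> makes its
  \<open>p\<close>-component real, so the imaginary part is the other coordinate times the area, and
  symmetrically for \<open>cnj q\<close>.\<close>

lemma coordinates_le:
  obtains C where "C > 0"
    "\<And>mn. \<bar>real_of_int (fst mn)\<bar> + \<bar>real_of_int (snd mn)\<bar> \<le> C * norm (lattice_point mn)"
proof -
  define d where "d = \<bar>Im (cnj p * q)\<bar>"
  have d: "d > 0" using indep by (simp add: d_def)
  define C where "C = (norm p + norm q) / d"
  have "p \<noteq> 0" using indep by auto
  hence C: "C > 0" using d by (auto simp: C_def add_pos_nonneg)
  have "\<bar>real_of_int m\<bar> + \<bar>real_of_int n\<bar> \<le> C * norm (lattice_point (m, n))" for m n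
  proof -
    let ?w = "lattice_point (m, n)"
    have "Im (cnj p * ?w) = n * Im (cnj p * q)"
      by (simp add: lattice_point_def algebra_simps)
    moreover have "Im (cnj q * ?w) = - m * Im (cnj p * q)"
      by (simp add: lattice_point_def algebra_simps)
    moreover have "\<bar>Im (cnj p * ?w)\<bar> \<le> norm p * norm ?w" "\<bar>Im (cnj q * ?w)\<bar> \<le> norm q * norm ?w"
      by (metis abs_Im_le_cmod complex_mod_cnj norm_mult)+
    ultimately have "\<bar>real_of_int n\<bar> * d \<le> norm p * norm ?w" "\<bar>real_of_int m\<bar> * d \<le> norm q * norm ?w"
      by (simp_all add: d_def abs_mult)
    hence "(\<bar>real_of_int m\<bar> + \<bar>real_of_int n\<bar>) * d \<le> (norm p + norm q) * norm ?w"
      by (simp add: algebra_simps)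
    thus ?thesis using d by (simp add: C_def field_simps)
  qed
  with C that show ?thesis by fastforce
qed

lemma lattice_point_0_iff: "lattice_point mn = 0 \<longleftrightarrow> mn = 0"
proof
  obtain C where C: "\<And>mn. \<bar>real_of_int (fst mn)\<bar> + \<bar>real_of_int (snd mn)\<bar> \<le> C * norm (lattice_point mn)"
    using coordinates_le by metis
  assume "lattice_point mn = 0"
  with C[of mn] show "mn = 0" by (auto simp: prod_eq_iff)
qed (auto simp: lattice_point_def)

lemma bij_lattice_point: "bij_betw lattice_point UNIV \<Lambda>"
proof -
  have "inj lattice_point"
  proof (rule injI)
    fix a b assume "lattice_point a = lattice_point b"
    hence "lattice_point (a - b) = 0" by (simp add: lattice_point_def algebra_simps)
    thus "a = b" by (simp add: lattice_point_0_iff)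
  qed
  moreover have "range lattice_point = \<Lambda>"
    by (force simp: period_lattice_def lattice_point_def image_iff)
  ultimately show ?thesis by (simp add: bij_betw_def)
qed

lemma lattice_0 [simp]: "0 \<in> \<Lambda>"
  by (auto simp: period_lattice_def intro: exI[of _ 0])

lemma lattice_uminus: "w \<in> \<Lambda> \<Longrightarrow> - w \<in> \<Lambda>"
  unfolding period_lattice_def
  by clarify (rule_tac x = "-m" in exI, rule_tac x = "-n" in exI, simp)

lemma finite_lattice_ball: "finite {w \<in> \<Lambda>. norm w < R}"
proof -
  obtain C where C: "C > 0"
    "\<And>mn. \<bar>real_of_int (fst mn)\<bar> + \<bar>real_of_int (snd mn)\<bar> \<le> C * norm (lattice_point mn)"
    using coordinates_le by metis
  define K where "K = \<lceil>C * R\<rceil>"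
  have "{w \<in> \<Lambda>. norm w < R} \<subseteq> lattice_point ` ({-K..K} \<times> {-K..K})"
  proof
    fix w assume w: "w \<in> {w \<in> \<Lambda>. norm w < R}"
    then obtain mn where mn: "w = lattice_point mn"
      using bij_lattice_point by (metis (no_types, lifting) bij_betw_iff_bijections mem_Collect_eq)
    have "\<bar>real_of_int (fst mn)\<bar> + \<bar>real_of_int (snd mn)\<bar> \<le> C * R"
      using C(2)[of mn] C(1) w mn by (smt (verit) mem_Collect_eq mult_le_cancel_left_pos)
    hence "\<bar>fst mn\<bar> \<le> K" "\<bar>snd mn\<bar> \<le> K"
      unfolding K_def by linarith+
    thus "w \<in> lattice_point ` ({-K..K} \<times> {-K..K})"
      unfolding mn by (intro imageI) (auto simp: mem_Times_iff)
  qed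
  thus ?thesis by (rule finite_subset) auto
qed

lemma summable_inverse_cube: "(\<lambda>w. 1 / norm w ^ 3) summable_on \<Lambda>"
proof -
  obtain C where C: "C > 0"
    "\<And>mn. \<bar>real_of_int (fst mn)\<bar> + \<bar>real_of_int (snd mn)\<bar> \<le> C * norm (lattice_point mn)"
    using coordinates_le by metis
  define u where "u = (\<lambda>m::int. (1 + real_of_int \<bar>m\<bar>) powr (-3/2))"
  have u: "u summable_on UNIV" unfolding u_def by (rule summable_on_int_weight)
  have "(\<lambda>mn. u (fst mn) * u (snd mn)) summable_on UNIV \<times> UNIV"
  proof (rule summable_on_SigmaI[where g = "\<lambda>m. u m * infsum u UNIV"])
    show "((\<lambda>n. u (fst (m, n)) * u (snd (m, n))) has_sum u m * infsum u UNIV) UNIV" for m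
      using u by (auto intro!: has_sum_cmult_right)
    show "(\<lambda>m. u m * infsum u UNIV) summable_on UNIV"
      using u by (rule summable_on_cmult_left)
  qed (auto simp: u_def)
  hence "(\<lambda>mn. (3/2*C)^3 * (u (fst mn) * u (snd mn))) summable_on UNIV"
    by (intro summable_on_cmult_right) auto
  hence "(\<lambda>mn. 1 / norm (lattice_point mn) ^ 3) summable_on UNIV"
  proof (rule summable_on_comparison_test)
    fix mn :: "int \<times> int"
    define m n where "m = real_of_int \<bar>fst mn\<bar>" and "n = real_of_int \<bar>snd mn\<bar>"
    define N where "N = norm (lattice_point mn)"
    have mn0: "m \<ge> 0" "n \<ge> 0" by (auto simp: m_def n_def)
    have le: "m + n \<le> C * N" using C(2)[of mn] by (simp add: m_def n_def N_def)
    show "1 / norm (lattice_point mn) ^ 3 \<le> (3/2*C)^3 * (u (fst mn) * u (snd mn))"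
    proof (cases "mn = 0")
      \<comment> \<open>The point 0 may stay in the index set: its term is
        \<open>1 / 0 = 0\<close>.\<close>
      case True
      hence "lattice_point mn = 0" by (simp add: lattice_point_0_iff)
      thus ?thesis using C(1) by (auto simp: u_def)
    next
      case False
      hence N: "N > 0" by (auto simp: N_def lattice_point_0_iff)
      from False have "m \<ge> 1 \<or> n \<ge> 1" by (auto simp: m_def n_def prod_eq_iff)
      hence mn1: "m + n \<ge> 1" using mn0 by auto
      \<comment> \<open>The arithmetic-geometric mean inequality passes from the product of the
        weights to the sum \<open>m + n\<close>, which the coordinate bound controls;
        \<open>m + n \<ge> 1\<close> absorbs the additive 2 and produces the factor 3/2.\<close>
      have "(1 + m) * (1 + n) \<le> ((2 + m + n) / 2)^2"
        using zero_le_power2[of "m - n"] by (simp add: power2_eq_square field_simps)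
      also have "\<dots> \<le> (3/2 * (m + n))^2"
        using mn0 mn1 by (intro power_mono) auto
      also have "\<dots> \<le> (3/2 * (C * N))^2"
        using mn0 mn1 le by (intro power_mono) auto
      finally have "((1 + m) * (1 + n)) powr (3/2) \<le> ((3/2 * (C * N))^2) powr (3/2)"
        using mn0 by (intro powr_mono2) auto
      also have "((3/2 * (C * N))^2) powr (3/2) = (3/2*C*N)^3"
      proof -
        have "((3/2 * (C * N))^2) = (3/2*C*N) powr 2"
          using C(1) N by (simp add: mult_ac)
        hence "((3/2 * (C * N))^2) powr (3/2) = (3/2*C*N) powr 3"
          by (simp only: powr_powr) simp
        thus ?thesis using C(1) N by simp
      qed
      finally have *: "(1 + m) powr (3/2) * (1 + n) powr (3/2) \<le> (3/2*C)^3 * N^3"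
        using mn0 by (simp add: powr_mult power_mult_distrib power_divide)
      have uu: "u (fst mn) = 1 / (1 + m) powr (3/2)" "u (snd mn) = 1 / (1 + n) powr (3/2)"
        by (simp_all add: u_def m_def n_def powr_minus_divide)
      show ?thesis
        unfolding uu using * N mn0 by (simp add: N_def[symmetric] field_simps)
    qed
  qed auto
  thus ?thesis
    using summable_on_reindex_bij_betw[OF bij_lattice_point, of "\<lambda>w. 1 / norm w ^ 3"] by simp
qed

lemma summable_tail:
  assumes "A \<subseteq> {w \<in> \<Lambda> - {0}. 2 * norm z \<le> norm w}"
  shows "(\<lambda>w. 1 / (z - w)^2 - 1 / w^2) summable_on A"
proof (rule abs_summable_summable, rule summable_on_comparison_test)
  show "(\<lambda>w. 10 * norm z * (1 / norm w ^ 3)) summable_on A"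
    using assms by (intro summable_on_cmult_right summable_on_subset[OF summable_inverse_cube]) auto
qed (use assms norm_lattice_term_le in auto)

lemma summable_terms: "(\<lambda>w. 1 / (z - w)^2 - 1 / w^2) summable_on \<Lambda>"
proof -
  let ?A = "{w \<in> \<Lambda>. norm w < 2 * norm z} \<union> {0}" and ?B = "{w \<in> \<Lambda> - {0}. 2 * norm z \<le> norm w}"
  have "(\<lambda>w. 1 / (z - w)^2 - 1 / w^2) summable_on ?A \<union> ?B"
    by (intro summable_on_union summable_on_finite summable_tail finite_UnI finite_lattice_ball) auto
  moreover have "?A \<union> ?B = \<Lambda>" by auto
  ultimately show ?thesis by simp
qed

text \<open>Since \<open>1 / 0 = 0\<close>, the principal part is the term for the lattice point \<open>0\<close>.\<close>

lemma weierstrass_p_infsum: "weierstrass_p p q z = (\<Sum>\<^sub>\<infinity>w\<in>\<Lambda>. 1 / (z - w)^2 - 1 / w^2)"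
proof -
  let ?f = "\<lambda>w. 1 / (z - w)^2 - 1 / w^2"
  have "infsum ?f \<Lambda> = infsum ?f ({0} \<union> (\<Lambda> - {0}))"
    by (intro arg_cong[where f = "infsum ?f"]) auto
  also have "\<dots> = infsum ?f {0} + infsum ?f (\<Lambda> - {0})"
    by (intro infsum_Un_disjoint summable_on_subset[OF summable_terms]) auto
  finally show ?thesis by (simp add: weierstrass_p_def)
qed

text \<open>Integer coordinates keep distinct lattice points at distance at least
  \<open>1 / C\<close>, so every subset of the lattice is closed. The set \<open>A\<close> is free
  in order to serve both the full lattice and the lattice without 0.\<close>

lemma open_minus_lattice: "open (- (\<Lambda> - A))"
proof -
  obtain C where C: "C > 0"
    "\<And>mn. \<bar>real_of_int (fst mn)\<bar> + \<bar>real_of_int (snd mn)\<bar> \<le> C * norm (lattice_point mn)"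
    using coordinates_le by metis
  have "closed (\<Lambda> - A)"
  proof (rule discrete_imp_closed[of "1 / C"])
    show "\<forall>x\<in>\<Lambda> - A. \<forall>y\<in>\<Lambda> - A. dist y x < 1 / C \<longrightarrow> y = x"
    proof (intro ballI impI)
      fix x y assume "x \<in> \<Lambda> - A" "y \<in> \<Lambda> - A" and less: "dist y x < 1 / C"
      then obtain a b where ab: "x = lattice_point a" "y = lattice_point b"
        using bij_lattice_point by (metis DiffD1 bij_betw_iff_bijections)
      have eq: "y - x = lattice_point (b - a)"
        by (simp add: ab lattice_point_def algebra_simps)
      have "C * norm (y - x) < 1" using less C(1) by (simp add: dist_norm field_simps)
      hence "\<bar>real_of_int (fst (b - a))\<bar> + \<bar>real_of_int (snd (b - a))\<bar> < 1"
        using C(2)[of "b - a"] unfolding eq by linarith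
      hence "b - a = 0" by (auto simp: prod_eq_iff)
      thus "y = x" by (simp add: ab)
    qed
  qed (use C in auto)
  thus ?thesis by (rule open_Compl)
qed

section \<open>Holomorphy, symmetries and periods of the Weierstrass function\<close>

text \<open>On the disk of radius \<open>R\<close> the sum is cut at \<open>2 * R\<close>: beyond
  the cut the third-order bound holds uniformly and the M-test applies, while the finitely many
  remaining terms have poles only at lattice points. The disks then exhaust the plane.\<close>

lemma holomorphic_regular_part: "regular_part holomorphic_on - (\<Lambda> - {0})"
proof -
  let ?f = "\<lambda>z w. 1 / (z - w)^2 - 1 / w^2"
  have "regular_part holomorphic_on (ball 0 R \<inter> - (\<Lambda> - {0}))" if R: "R > 0" for R
  proof -
    define A B where "A = {w \<in> \<Lambda> - {0}. norm w < 2 * R}" and "B = {w \<in> \<Lambda> - {0}. 2 * R \<le> norm w}"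
    have fin: "finite A" unfolding A_def by (rule finite_subset[OF _ finite_lattice_ball[of "2*R"]]) auto
    have ulim: "uniform_limit (cball 0 R) (\<lambda>X z. \<Sum>w\<in>X. ?f z w) (\<lambda>z. \<Sum>\<^sub>\<infinity>w\<in>B. ?f z w) (finite_subsets_at_top B)"
    proof (rule Weierstrass_m_test_general)
      show "(\<lambda>w. 10 * R * (1 / norm w ^ 3)) summable_on B"
        by (intro summable_on_cmult_right summable_on_subset[OF summable_inverse_cube]) (auto simp: B_def)
      show "norm (?f z w) \<le> 10 * R * (1 / norm w ^ 3)" if "w \<in> B" "z \<in> cball 0 R" for z w
      proof -
        have "norm (?f z w) \<le> 10 * norm z / norm w ^ 3"
          using that by (intro norm_lattice_term_le) (auto simp: B_def)
        also have "\<dots> \<le> 10 * R / norm w ^ 3"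
          using that by (intro divide_right_mono) auto
        finally show ?thesis by simp
      qed
    qed
    have 1: "(\<lambda>z. \<Sum>\<^sub>\<infinity>w\<in>B. ?f z w) holomorphic_on ball 0 R"
    proof (rule holomorphic_uniform_limit[OF _ ulim])
      show "\<forall>\<^sub>F X in finite_subsets_at_top B.
        continuous_on (cball 0 R) (\<lambda>z. \<Sum>w\<in>X. ?f z w) \<and> (\<lambda>z. \<Sum>w\<in>X. ?f z w) holomorphic_on ball 0 R"
      proof (rule eventually_mono[rotated])
        show "\<forall>\<^sub>F X in finite_subsets_at_top B. finite X \<and> X \<subseteq> B"
          by (rule eventually_finite_subsets_at_top_weakI) auto
        fix X assume X: "finite X \<and> X \<subseteq> B"
        have "z - w \<noteq> 0" if "z \<in> cball 0 R" "w \<in> X" for z w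
          using that X R by (auto simp: B_def)
        thus "continuous_on (cball 0 R) (\<lambda>z. \<Sum>w\<in>X. ?f z w) \<and> (\<lambda>z. \<Sum>w\<in>X. ?f z w) holomorphic_on ball 0 R"
          using X by (auto intro!: continuous_intros holomorphic_intros simp: B_def)
      qed
    qed auto
    have 2: "(\<lambda>z. \<Sum>w\<in>A. ?f z w) holomorphic_on - (\<Lambda> - {0})"
      by (auto intro!: holomorphic_intros simp: A_def)
    have 3: "regular_part z = (\<Sum>w\<in>A. ?f z w) + (\<Sum>\<^sub>\<infinity>w\<in>B. ?f z w)" for z
    proof -
      have "regular_part z = infsum (?f z) (A \<union> B)"
        unfolding regular_part_def by (intro arg_cong[where f = "infsum _"]) (auto simp: A_def B_def)
      also have "\<dots> = infsum (?f z) A + infsum (?f z) B"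
        by (intro infsum_Un_disjoint summable_on_subset[OF summable_terms]) (auto simp: A_def B_def)
      finally show ?thesis using fin by simp
    qed
    show ?thesis
      unfolding 3[abs_def]
      by (intro holomorphic_on_add holomorphic_on_subset[OF 1] holomorphic_on_subset[OF 2]) auto
  qed
  hence "regular_part holomorphic_on (\<Union>R\<in>{0<..}. ball 0 R \<inter> - (\<Lambda> - {0}))"
    by (intro holomorphic_on_UN_open open_Int open_minus_lattice) auto
  also have "(\<Union>R\<in>{0<..}. ball 0 R \<inter> - (\<Lambda> - {0})) = - (\<Lambda> - {0})"
  proof -
    have "z \<in> ball 0 (norm z + 1)" "norm z + 1 > 0" for z :: complex by (auto simp: add_nonneg_pos)
    thus ?thesis by blast
  qed
  finally show ?thesis .
qed

lemma regular_part_0 [simp]: "regular_part 0 = 0"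
  by (simp add: regular_part_def)

lemma holomorphic_weierstrass_p: "weierstrass_p p q holomorphic_on - \<Lambda>"
  unfolding weierstrass_p_eq[abs_def]
  by (intro holomorphic_intros holomorphic_on_subset[OF holomorphic_regular_part]) auto

lemma weierstrass_p_uminus: "weierstrass_p p q (- z) = weierstrass_p p q z"
proof -
  have "bij_betw uminus \<Lambda> \<Lambda>"
    by (rule bij_betwI[where g = uminus]) (auto simp: lattice_uminus)
  hence "infsum (\<lambda>w. 1 / (z - (-w))^2 - 1 / (-w)^2) \<Lambda> = infsum (\<lambda>w. 1 / (z - w)^2 - 1 / w^2) \<Lambda>"
    by (rule infsum_reindex_bij_betw)
  moreover have "(z - (-w))^2 = (- z - w)^2" for w
    by (simp add: power2_eq_square algebra_simps)
  ultimately show ?thesis by (simp add: weierstrass_p_infsum)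
qed

lemma weierstrass_p_cnj:
  assumes "cnj ` \<Lambda> = \<Lambda>"
  shows "weierstrass_p p q (cnj z) = cnj (weierstrass_p p q z)"
proof -
  have "bij_betw cnj \<Lambda> \<Lambda>"
    using assms by (auto simp: bij_betw_def inj_on_def)
  hence "infsum (\<lambda>w. 1 / (cnj z - cnj w)^2 - 1 / (cnj w)^2) \<Lambda> = infsum (\<lambda>w. 1 / (cnj z - w)^2 - 1 / w^2) \<Lambda>"
    by (rule infsum_reindex_bij_betw)
  moreover have "infsum (\<lambda>w. 1 / (cnj z - cnj w)^2 - 1 / (cnj w)^2) \<Lambda>
      = infsum (\<lambda>w. cnj (1 / (z - w)^2 - 1 / w^2)) \<Lambda>"
    by (rule infsum_cong) simp
  ultimately show ?thesis by (simp add: weierstrass_p_infsum del: complex_cnj_diff)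
qed

text \<open>The bare terms are summable along a single row, where the norm grows linearly, although
  not over the whole lattice. This is what allows the telescoping below to be done row by
  row.\<close>

lemma summable_row: "(\<lambda>m. 1 / (z - lattice_point (m, n))^2) summable_on UNIV"
proof -
  have inj: "inj (\<lambda>m. lattice_point (m, n))"
    using bij_lattice_point by (auto simp: bij_betw_def inj_on_def)
  have 1: "(\<lambda>m. 1 / (z - lattice_point (m, n))^2 - 1 / (lattice_point (m, n))^2) summable_on UNIV"
  proof -
    have "range (\<lambda>m. lattice_point (m, n)) \<subseteq> \<Lambda>"
      using bij_lattice_point by (auto simp: bij_betw_def)
    from summable_on_subset[OF summable_terms this]
    show ?thesis using inj by (subst (asm) summable_on_reindex) (auto simp: o_def)
  qed
  have 2: "(\<lambda>m. 1 / (lattice_point (m, n))^2) summable_on UNIV"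
  proof -
    obtain C where C: "C > 0"
      "\<And>mn. \<bar>real_of_int (fst mn)\<bar> + \<bar>real_of_int (snd mn)\<bar> \<le> C * norm (lattice_point mn)"
      using coordinates_le by metis
    \<comment> \<open>At index 0 the coordinate bound gives no lower estimate of the norm; this
      single term is added back afterwards.\<close>
    have "(\<lambda>m. 1 / (lattice_point (m, n))^2) summable_on (- {0})"
    proof (rule abs_summable_summable, rule summable_on_comparison_test)
      show "(\<lambda>m::int. 4 * C^2 * ((1 + real_of_int \<bar>m\<bar>) powr (-3/2))) summable_on - {0}"
        by (intro summable_on_cmult_right summable_on_subset[OF summable_on_int_weight]) auto
      fix m :: int assume "m \<in> - {0}"
      hence m: "real_of_int \<bar>m\<bar> \<ge> 1" by auto
      let ?M = "real_of_int \<bar>m\<bar>" and ?N = "norm (lattice_point (m, n))"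
      have le: "?M \<le> C * ?N" using C(2)[of "(m, n)"] by simp
      hence "0 < C * ?N" using m by linarith
      hence N: "?N > 0" using C(1) by (simp add: zero_less_mult_iff)
      have "(1 + ?M) powr (3/2) \<le> (1 + ?M) powr 2"
        using m by (intro powr_mono) auto
      also have "\<dots> = (1 + ?M)^2" by simp
      also have "\<dots> \<le> (2 * (C * ?N))^2"
        using m le by (intro power_mono) auto
      finally have "(1 + ?M) powr (3/2) \<le> 4 * C^2 * ?N^2"
        by (simp add: power_mult_distrib)
      thus "norm (1 / (lattice_point (m, n))^2) \<le> 4 * C^2 * ((1 + ?M) powr (-3/2))"
        using N m by (simp add: norm_divide norm_power powr_minus_divide field_simps)
    qed auto
    from summable_on_union[OF this, of "{0}"] show ?thesis by (simp add: insert_UNIV Compl_eq_Diff_UNIV)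
  qed
  from summable_on_add[OF 1 2] show ?thesis by simp
qed

text \<open>Summed along a row of the lattice in the direction of the period, the difference
  telescopes.\<close>

lemma weierstrass_p_plus_period1: "weierstrass_p p q (z + p) = weierstrass_p p q z"
proof -
  define b where "b = (\<lambda>w. 1 / (z - w)^2)"
  define d where "d = (\<lambda>w. 1 / (z + p - w)^2 - 1 / (z - w)^2)"
  have eq: "d w = (1 / (z + p - w)^2 - 1 / w^2) - (1 / (z - w)^2 - 1 / w^2)" for w
    by (simp add: d_def)
  have "weierstrass_p p q (z + p) - weierstrass_p p q z = infsum d \<Lambda>"
    unfolding weierstrass_p_infsum eq by (intro infsumI[symmetric] has_sum_diff summable_terms)
  also have "\<dots> = infsum (\<lambda>mn. d (lattice_point mn)) UNIV"
    using infsum_reindex_bij_betw[OF bij_lattice_point, of d] by simp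
  \<comment> \<open>The swap makes the coefficient of \<open>p\<close> the inner summation index.
    Iterated summation is legitimate because \<open>d\<close> is a difference of two summable
    families.\<close>
  also have "\<dots> = infsum (\<lambda>mn. d (lattice_point (prod.swap mn))) UNIV"
    by (rule infsum_reindex_bij_betw[symmetric, where g = prod.swap]) auto
  also have "\<dots> = infsum (\<lambda>n. infsum (\<lambda>m. d (lattice_point (m, n))) UNIV) UNIV"
  proof -
    have "d summable_on \<Lambda>"
      unfolding eq using has_sum_diff[OF summable_terms summable_terms] by (rule has_sum_imp_summable)
    hence "(\<lambda>mn. d (lattice_point mn)) summable_on UNIV"
      using summable_on_reindex_bij_betw[OF bij_lattice_point, of d] by simp
    hence "(\<lambda>mn. d (lattice_point (prod.swap mn))) summable_on UNIV"
      by (subst summable_on_reindex_bij_betw[where g = prod.swap]) auto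
    thus ?thesis
      using infsum_Sigma_banach[of "\<lambda>mn. d (lattice_point (prod.swap mn))" UNIV "\<lambda>_. UNIV"] by simp
  qed
  also have "\<dots> = 0"
  proof -
    have "d (lattice_point (m, n)) = b (lattice_point (m - 1, n)) - b (lattice_point (m, n))" for m n
      by (simp add: d_def b_def lattice_point_def algebra_simps)
    moreover have "infsum (\<lambda>m. b (lattice_point (m - 1, n)) - b (lattice_point (m, n))) UNIV = 0" for n
      unfolding b_def by (rule infsum_int_telescope) (rule summable_row)
    ultimately show ?thesis by simp
  qed
  finally show ?thesis by simp
qed

lemma weierstrass_p_plus_period2: "weierstrass_p p q (z + q) = weierstrass_p p q z"
proof -
  interpret swap: lattice_basis q p
    using indep by unfold_locales (simp add: algebra_simps)
  show ?thesis
    using swap.weierstrass_p_plus_period1 by (simp add: weierstrass_p_commute)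
qed

lemma weierstrass_p_plus_lattice:
  assumes "w \<in> \<Lambda>"
  shows "weierstrass_p p q (z + w) = weierstrass_p p q z"
proof -
  have mult: "weierstrass_p p q (z + of_int m * r) = weierstrass_p p q z"
    if r: "\<And>z. weierstrass_p p q (z + r) = weierstrass_p p q z" for r m z
  proof (induction m rule: int_induct[where k = 0])
    case (step1 i)
    thus ?case using r[of "z + of_int i * r"] by (simp add: algebra_simps)
  next
    case (step2 i)
    thus ?case using r[of "z + of_int (i - 1) * r"] by (simp add: algebra_simps)
  qed simp
  obtain m n where "w = of_int m * p + of_int n * q"
    using assms by (auto simp: period_lattice_def)
  thus ?thesis
    using mult[OF weierstrass_p_plus_period2, of "z + of_int m * p" n]
      mult[OF weierstrass_p_plus_period1, of z m]
    by (simp add: add_ac)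
qed

end

subsection \<open>The elliptic integral on the closed disk\<close>

lemma complex_eq_1_if_norm_le_1:
  assumes "norm (w::complex) \<le> 1" "Re w = 1" shows "w = 1"
proof -
  have "(Re w)^2 + (Im w)^2 \<le> 1"
    using assms(1) by (metis cmod_power2 norm_ge_zero power_le_one)
  thus ?thesis using assms(2) by (simp add: complex_eq_iff)
qed

lemma quartic_factor: "quartic t u = (1 - u^2 * cis (2*t)) * (1 - u^2 * cis (-(2*t)))"
proof -
  have c: "cis (2*t) + cis (-(2*t)) = 2 * of_real (cos (2*t))"
    by (simp add: complex_eq_iff)
  have "(1 - u^2 * cis (2*t)) * (1 - u^2 * cis (-(2*t))) =
      1 - u^2 * (cis (2*t) + cis (-(2*t))) + u^4 * (cis (2*t) * cis (-(2*t)))"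
    by (simp add: algebra_simps power4_eq_xxxx power2_eq_square)
  thus ?thesis by (simp only: c cis_mult) (simp add: quartic_def algebra_simps)
qed

text \<open>Both factors lie in the closed right half plane, so a negative real product would force
  both onto the imaginary axis. But each factor lies in the disk of radius 1 about 1, which meets
  that axis only at 0.\<close>

lemma quartic_nonpos_Reals_imp_0:
  assumes "u \<in> cball 0 1" "quartic t u \<in> \<real>\<^sub>\<le>\<^sub>0"
  shows "quartic t u = 0"
proof (rule ccontr)
  assume nz: "quartic t u \<noteq> 0"
  define a b where "a = 1 - u^2 * cis (2*t)" and "b = 1 - u^2 * cis (-(2*t))"
  have ab: "quartic t u = a * b" unfolding a_def b_def by (rule quartic_factor)
  have n: "norm (u^2 * cis x) \<le> 1" for x
    using assms(1) by (simp add: norm_mult norm_power power_le_one)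
  have re: "Re a \<ge> 0" "Re b \<ge> 0"
    using complex_Re_le_cmod[of "u^2 * cis (2*t)"] complex_Re_le_cmod[of "u^2 * cis (-(2*t))"]
      n[of "2*t"] n[of "-(2*t)"] unfolding a_def b_def minus_complex.sel one_complex.sel by linarith+
  have im: "Im (a * b) = 0" and le: "Re (a * b) \<le> 0"
    using assms(2) by (auto simp: ab complex_nonpos_Reals_iff)
  have im': "Re a * Im b = - (Im a * Re b)" using im by (simp add: algebra_simps)
  hence "Re a * Re (a * b) = Re b * ((Re a)\<^sup>2 + (Im a)\<^sup>2)"
    by (simp add: algebra_simps power2_eq_square)
  moreover have "Re a * Re (a * b) \<le> 0" using re le by (intro mult_nonneg_nonpos) auto
  moreover have "(Re a)\<^sup>2 + (Im a)\<^sup>2 > 0"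
    using nz ab by (auto simp: sum_power2_gt_zero_iff complex_eq_iff)
  ultimately have "Re b = 0" using re(2) by (smt (verit) mult_pos_pos)
  hence "u^2 * cis (-(2*t)) = 1"
    by (intro complex_eq_1_if_norm_le_1 n) (simp add: b_def)
  thus False using nz ab by (simp add: b_def)
qed

lemma quartic_eq_0_iff: "quartic t u = 0 \<longleftrightarrow> u \<in> prevertices t"
proof -
  have 1: "1 - u^2 * cis (2*x) = 0 \<longleftrightarrow> u = cis (-x) \<or> u = - cis (-x)" for x
  proof -
    have "1 - u^2 * cis (2*x) = 0 \<longleftrightarrow> u^2 * cis (2*x) * cis (-(2*x)) = cis (-(2*x))"
      by (metis (no_types, lifting) cis_neq_zero mult_cancel_right mult_1 right_minus_eq)
    also have "\<dots> \<longleftrightarrow> u^2 = (cis (-x))^2"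
      by (simp add: mult.assoc cis_mult Complex.DeMoivre)
    finally show ?thesis by (simp add: power2_eq_iff)
  qed
  show ?thesis
    unfolding quartic_factor mult_eq_0_iff using 1[of t] 1[of "-t"]
    by (auto simp: prevertices_def)
qed

lemma quartic_uminus [simp]: "quartic t (- u) = quartic t u"
  by (simp add: quartic_def)

lemma quartic_cnj: "quartic t (cnj u) = cnj (quartic t u)"
  by (simp add: quartic_def)

lemma quartic_0 [simp]: "quartic t 0 = 1"
  by (simp add: quartic_def)

lemma has_field_derivative_quartic [derivative_intros]:
  "(f has_field_derivative f') (at z within A) \<Longrightarrow>
   ((\<lambda>z. quartic t (f z)) has_field_derivative (4 * f z ^ 3 - 4 * of_real (cos (2*t)) * f z) * f') (at z within A)"
  unfolding quartic_def by (auto intro!: derivative_eq_intros simp: algebra_simps power3_eq_cube)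

lemma continuous_on_quartic [continuous_intros]:
  "continuous_on A f \<Longrightarrow> continuous_on A (\<lambda>z. quartic t (f z))"
  unfolding quartic_def by (intro continuous_intros)

lemma holomorphic_on_quartic [holomorphic_intros]:
  "f holomorphic_on A \<Longrightarrow> (\<lambda>z. quartic t (f z)) holomorphic_on A"
  unfolding quartic_def by (intro holomorphic_intros)

lemma quartic_ball_nz: "u \<in> ball 0 1 \<Longrightarrow> quartic t u \<noteq> 0"
  using quartic_notin_nonpos_Reals[of u t] by auto

text \<open>Away from the corners the quartic avoids the branch cut. At a corner the choice of
  branch is irrelevant, since the modulus of the root tends to 0.\<close>

lemma continuous_on_csqrt_quartic: "continuous_on (cball 0 1) (\<lambda>u. csqrt (quartic t u))"
  unfolding continuous_on_def
proof
  fix u :: complex assume u: "u \<in> cball 0 1"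
  have Q: "(quartic t \<longlongrightarrow> quartic t u) (at u within cball 0 1)"
    using u continuous_on_quartic[of "cball 0 1" "\<lambda>z. z" t] by (auto simp: continuous_on_def)
  show "((\<lambda>u. csqrt (quartic t u)) \<longlongrightarrow> csqrt (quartic t u)) (at u within cball 0 1)"
  proof (cases "quartic t u = 0")
    case True
    have "((\<lambda>u. sqrt (norm (quartic t u))) \<longlongrightarrow> sqrt (norm (quartic t u))) (at u within cball 0 1)"
      by (intro tendsto_intros Q)
    hence "((\<lambda>u. norm (csqrt (quartic t u))) \<longlongrightarrow> 0) (at u within cball 0 1)"
      by (simp add: True)
    hence "((\<lambda>u. csqrt (quartic t u)) \<longlongrightarrow> 0) (at u within cball 0 1)"
      by (rule tendsto_norm_zero_cancel)
    thus ?thesis using True by simp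
  next
    case False
    hence "quartic t u \<notin> \<real>\<^sub>\<le>\<^sub>0" using quartic_nonpos_Reals_imp_0 u by blast
    thus ?thesis by (intro isCont_tendsto_compose[OF _ Q]) auto
  qed
qed

lemma Re_csqrt_pos:
  assumes "z \<notin> \<real>\<^sub>\<le>\<^sub>0"
  shows "Re (csqrt z) > 0"
proof (rule ccontr)
  assume "\<not> ?thesis"
  hence re: "Re (csqrt z) = 0" using csqrt_principal[of z] by auto
  have "z = (csqrt z)^2" by simp
  also have "\<dots> \<in> \<real>\<^sub>\<le>\<^sub>0"
    using re by (simp add: complex_nonpos_Reals_iff power2_eq_square del: power2_csqrt)
  finally show False using assms by simp
qed

lemma cnj_csqrt_quartic:
  assumes "u \<in> cball 0 1"
  shows "csqrt (quartic t (cnj u)) = cnj (csqrt (quartic t u))"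
proof (cases "quartic t u = 0")
  case False
  hence "quartic t u \<notin> \<real>\<^sub>\<le>\<^sub>0" using quartic_nonpos_Reals_imp_0[OF assms] by blast
  thus ?thesis using cnj_csqrt by (simp add: quartic_cnj)
qed (auto simp: quartic_cnj)

section \<open>The elliptic integral and its singular part at the corners\<close>

text \<open>This form holds without an integrability condition, so the symmetries read off from it
  include the boundary points.\<close>

lemma elliptic_E_integral:
  "elliptic_E t z = integral {0..1} (\<lambda>x. 1 / csqrt (quartic t (of_real x * z)) * z)"
  by (simp add: elliptic_E_def contour_integral_integral linepath_def scaleR_conv_of_real)

lemma elliptic_E_uminus: "elliptic_E t (- z) = - elliptic_E t z"
  by (simp add: elliptic_E_integral)

lemma elliptic_E_cnj:
  assumes "z \<in> cball 0 1"
  shows "elliptic_E t (cnj z) = cnj (elliptic_E t z)"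
proof -
  have "csqrt (quartic t (of_real x * cnj z)) = cnj (csqrt (quartic t (of_real x * z)))"
    if "x \<in> {0..1}" for x
  proof -
    have "norm (of_real x * z) \<le> 1" using that assms by (auto simp: norm_mult mult_le_one)
    thus ?thesis using cnj_csqrt_quartic[of "of_real x * z"] by simp
  qed
  thus ?thesis unfolding elliptic_E_integral integral_cnj
    by (intro integral_cong) simp
qed

lemma elliptic_E_0 [simp]: "elliptic_E t 0 = 0"
  by (simp add: elliptic_E_integral)

lemma has_field_derivative_elliptic_E:
  assumes z: "z \<in> ball 0 1"
  shows "(elliptic_E t has_field_derivative 1 / csqrt (quartic t z)) (at z)"
proof -
  have "(\<lambda>u. 1 / csqrt (quartic t u)) holomorphic_on ball 0 1"
    using quartic_ball_nz by (auto intro!: holomorphic_intros csqrt_quartic_branch)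
  then obtain P where P: "\<And>x. x \<in> ball 0 1 \<Longrightarrow> (P has_field_derivative 1 / csqrt (quartic t x)) (at x within ball 0 1)"
    using holomorphic_convex_primitive'[of "ball 0 1"] by (metis convex_ball open_ball)
  have eq: "elliptic_E t x = P x - P 0" if "x \<in> ball 0 1" for x
  proof -
    have "closed_segment 0 x \<subseteq> ball 0 1"
      using that by (intro closed_segment_subset) auto
    hence "((\<lambda>u. 1 / csqrt (quartic t u)) has_contour_integral (P (pathfinish (linepath 0 x)) - P (pathstart (linepath 0 x)))) (linepath 0 x)"
      by (intro contour_integral_primitive[OF P]) auto
    thus ?thesis unfolding elliptic_E_def by (intro contour_integral_unique) simp
  qed
  have "((\<lambda>x. P x - P 0) has_field_derivative 1 / csqrt (quartic t z)) (at z)"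
    using P[OF z] z by (auto intro!: derivative_eq_intros simp: at_within_open[OF z])
  thus ?thesis
    by (rule DERIV_cong_ev[THEN iffD1, rotated 3])
       (use eq z in \<open>auto intro!: eventually_nhds_in_open[THEN eventually_mono, of "ball 0 1"]\<close>)
qed

lemma holomorphic_elliptic_E: "elliptic_E t holomorphic_on ball 0 1"
  using has_field_derivative_elliptic_E field_differentiable_at_within
  unfolding holomorphic_on_def field_differentiable_def by blast

text \<open>Subtracting \<open>corner_factor \<cdot> \<surd>Q\<close> from \<open>elliptic_E\<close> leaves a function whose derivative
  is continuous up to the corners, because \<open>corner_factor\<close> interpolates \<open>2 / Q'\<close> at the four zeros
  of the quartic \<open>Q\<close>.\<close>

definition corner_factor :: "real \<Rightarrow> complex \<Rightarrow> complex" where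
  "corner_factor t z = - z * (of_real (cos (2*t)) * (z^2 - of_real (cos (2*t))) + of_real (sin (2*t))^2) / (2 * of_real (sin (2*t))^2)"

text \<open>This is \<open>1 / csqrt Q\<close> minus the derivative of
  \<open>corner_factor * csqrt Q\<close>, with the division by Q carried out: a polynomial times
  \<open>csqrt Q\<close>, hence bounded at the corners.\<close>

definition remainder_integrand :: "real \<Rightarrow> complex \<Rightarrow> complex" where
  "remainder_integrand t z = csqrt (quartic t z) *
     (1 + of_real (cos (2*t)) * z^2 / of_real (sin (2*t))^2 + (of_real (cos (2*t)) * (3 * z^2 - of_real (cos (2*t))) + of_real (sin (2*t))^2) / (2 * of_real (sin (2*t))^2))"

definition remainder :: "real \<Rightarrow> complex \<Rightarrow> complex" where
  "remainder t z = integral (cbox 0 1) (\<lambda>x. remainder_integrand t (of_real x * z) * z)"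

lemma continuous_on_remainder_integrand: "continuous_on (cball 0 1) (remainder_integrand t)"
  unfolding remainder_integrand_def
  by (cases "sin (2*t) = 0") (auto intro!: continuous_intros continuous_on_csqrt_quartic)

lemma continuous_on_corner_factor: "continuous_on A (corner_factor t)"
  unfolding corner_factor_def
  by (cases "sin (2*t) = 0") (auto intro!: continuous_intros)

lemma corner_factor_derivative:
  assumes z: "z \<in> ball 0 1" and s: "sin (2*t) \<noteq> 0"
  shows "((\<lambda>z. corner_factor t z * csqrt (quartic t z)) has_field_derivative
           1 / csqrt (quartic t z) - remainder_integrand t z) (at z)"
proof -
  define r where "r = csqrt (quartic t z)"
  define c s :: complex where "c = of_real (cos (2*t))" and "s = of_real (sin (2*t))"
  have r: "r \<noteq> 0" using quartic_ball_nz[OF z] by (simp add: r_def)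
  have r2: "r^2 = z^4 - 2 * c * z^2 + 1" by (simp add: r_def quartic_def c_def)
  have s0: "s \<noteq> 0" using s by (simp add: s_def)
  have cs: "c^2 + s^2 = 1"
    unfolding c_def s_def by (simp flip: of_real_power of_real_add)
  have "(corner_factor t has_field_derivative - (c * (3*z^2 - c) + s^2) / (2 * s^2)) (at z)"
    unfolding corner_factor_def[abs_def] c_def[symmetric] s_def[symmetric]
    using s0 by (auto intro!: derivative_eq_intros simp: divide_simps) algebra
  moreover have "((\<lambda>z. csqrt (quartic t z)) has_field_derivative (4*z^3 - 4*c*z) / (2 * r)) (at z)"
    using quartic_notin_nonpos_Reals[OF z]
    by (auto intro!: derivative_eq_intros simp: r_def c_def)
  ultimately have D: "((\<lambda>z. corner_factor t z * csqrt (quartic t z)) has_field_derivative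
     corner_factor t z * ((4*z^3 - 4*c*z) / (2 * r)) + (- (c * (3*z^2 - c) + s^2) / (2 * s^2)) * r) (at z)"
    unfolding r_def by (rule DERIV_mult')
  have eq: "corner_factor t z * ((4*z^3 - 4*c*z) / (2 * r)) + (- (c * (3*z^2 - c) + s^2) / (2 * s^2)) * r =
     1 / r - r * (1 + c * z^2 / s^2 + (c * (3 * z^2 - c) + s^2) / (2 * s^2))"
  proof -
    \<comment> \<open>A Bezout identity: \<open>corner_factor\<close> inverts Q' / 2 modulo Q, with
      cofactor \<open>1 + c * z^2 / s^2\<close>. Thus the singular terms \<open>1 / r\<close> cancel
      exactly.\<close>
    have "corner_factor t z * (2*z^3 - 2*c*z) = 1 - r^2 * (1 + c * z^2 / s^2)"
      unfolding corner_factor_def c_def[symmetric] s_def[symmetric] r2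
      using s0 cs by (simp add: divide_simps) algebra
    moreover have "corner_factor t z * ((4*z^3 - 4*c*z) / (2 * r)) = corner_factor t z * (2*z^3 - 2*c*z) / r"
      using r by (simp add: field_simps)
    ultimately have "corner_factor t z * ((4*z^3 - 4*c*z) / (2 * r)) = 1 / r - r * (1 + c * z^2 / s^2)"
      using r by (simp add: diff_divide_distrib power2_eq_square)
    thus ?thesis by (simp add: algebra_simps diff_divide_distrib add_divide_distrib)
  qed
  show ?thesis
    using D unfolding eq unfolding remainder_integrand_def r_def c_def s_def by simp
qed

text \<open>The fundamental theorem of calculus asks only for continuity at the endpoints of the
  segment. So it also evaluates the integral ending at a corner, where the integrand is
  unbounded.\<close>

lemma elliptic_E_decomposition:
  assumes z: "z \<in> cball 0 1" and s: "sin (2*t) \<noteq> 0"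
  shows "elliptic_E t z = remainder t z + corner_factor t z * csqrt (quartic t z)"
proof -
  let ?\<Phi> = "\<lambda>u. corner_factor t u * csqrt (quartic t u)"
  have in_cball: "of_real x * z \<in> cball 0 1" if "x \<in> {0..1}" for x :: real
    using that z by (auto simp: norm_mult mult_le_one)
  have in_ball: "of_real x * z \<in> ball 0 1" if "x \<in> {0<..<1}" for x :: real
  proof -
    have "norm (of_real x * z) \<le> \<bar>x\<bar> * 1" unfolding norm_mult using z by (intro mult_mono) auto
    thus ?thesis using that by auto
  qed
  have "((\<lambda>x. (1 / csqrt (quartic t (of_real x * z)) - remainder_integrand t (of_real x * z)) * z)
      has_integral (?\<Phi> (of_real 1 * z) - ?\<Phi> (of_real 0 * z))) {0..1}"
  proof (rule fundamental_theorem_of_calculus_interior)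
    show "continuous_on {0..1} (\<lambda>x. ?\<Phi> (of_real x * z))"
      by (rule continuous_on_compose2[of "cball 0 1" ?\<Phi>])
         (use in_cball in \<open>auto intro!: continuous_intros continuous_on_corner_factor continuous_on_csqrt_quartic\<close>)
    fix x :: real assume x: "x \<in> {0<..<1}"
    have "((\<lambda>u. ?\<Phi> (u * z)) has_field_derivative
        (1 / csqrt (quartic t (of_real x * z)) - remainder_integrand t (of_real x * z)) * z) (at (of_real x))"
      by (rule DERIV_chain2[where f = ?\<Phi> and g = "\<lambda>u. u * z", OF corner_factor_derivative[OF in_ball[OF x] s]])
         (auto intro!: derivative_eq_intros)
    thus "((\<lambda>x. ?\<Phi> (of_real x * z)) has_vector_derivative
        (1 / csqrt (quartic t (of_real x * z)) - remainder_integrand t (of_real x * z)) * z) (at x)"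
      by (rule has_vector_derivative_real_field)
  qed simp
  moreover have "((\<lambda>x. remainder_integrand t (of_real x * z) * z) has_integral remainder t z) {0..1}"
    unfolding remainder_def cbox_interval
    by (intro integrable_integral integrable_continuous_real continuous_intros
         continuous_on_compose2[OF continuous_on_remainder_integrand])
       (use in_cball in auto)
  ultimately have "((\<lambda>x. (1 / csqrt (quartic t (of_real x * z)) - remainder_integrand t (of_real x * z)) * z
      + remainder_integrand t (of_real x * z) * z) has_integral
      (?\<Phi> (of_real 1 * z) - ?\<Phi> (of_real 0 * z)) + remainder t z) {0..1}"
    by (rule has_integral_add)
  hence "((\<lambda>x. 1 / csqrt (quartic t (of_real x * z)) * z) has_integral ?\<Phi> z + remainder t z) {0..1}"
    by (simp add: algebra_simps corner_factor_def)
  thus ?thesis unfolding elliptic_E_integral by (simp add: integral_unique add.commute)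
qed

lemma continuous_on_remainder: "continuous_on (cball 0 1) (remainder t)"
  unfolding remainder_def[abs_def]
proof (rule integral_continuous_on_param)
  show "continuous_on (cball 0 1 \<times> cbox 0 1) (\<lambda>(z, x). remainder_integrand t (of_real x * z) * z)"
    unfolding case_prod_unfold
    by (intro continuous_intros continuous_on_compose2[OF continuous_on_remainder_integrand])
       (auto simp: norm_mult mult_le_one)
qed

lemma continuous_on_elliptic_E:
  assumes s: "sin (2*t) \<noteq> 0"
  shows "continuous_on (cball 0 1) (elliptic_E t)"
proof -
  have "continuous_on (cball 0 1) (\<lambda>z. remainder t z + corner_factor t z * csqrt (quartic t z))"
    by (intro continuous_intros continuous_on_remainder continuous_on_corner_factor continuous_on_csqrt_quartic)
  thus ?thesis
    by (rule continuous_on_eq) (simp add: elliptic_E_decomposition s)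
qed

lemma field_differentiable_bound_closure:
  fixes f :: "complex \<Rightarrow> complex"
  assumes S: "convex S" and df: "\<And>z. z \<in> S \<Longrightarrow> (f has_field_derivative f' z) (at z within S)"
    and dn: "\<And>z. z \<in> S \<Longrightarrow> norm (f' z) \<le> B"
    and cont: "continuous_on (closure S) f" and B: "0 \<le> B" and xy: "x \<in> closure S" "y \<in> closure S"
  shows "norm (f x - f y) \<le> B * norm (x - y)"
proof -
  have "B-lipschitz_on S f"
    by (intro lipschitz_onI B) (use field_differentiable_bound[OF S df dn] in \<open>auto simp: dist_norm\<close>)
  from lipschitz_onD[OF lipschitz_on_closure[OF this cont] xy]
  show ?thesis by (simp add: dist_norm)
qed

text \<open>Near a corner \<open>csqrt Q\<close> has the order of the square root of the distance,
  so a Lipschitz term is negligible beside it.\<close>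

lemma remainder_lipschitz:
  assumes s: "sin (2*t) \<noteq> 0"
  obtains B where "\<And>x y. x \<in> cball 0 1 \<Longrightarrow> y \<in> cball 0 1 \<Longrightarrow> norm (remainder t x - remainder t y) \<le> B * norm (x - y)"
proof -
  have "compact (remainder_integrand t ` cball 0 1)"
    by (intro compact_continuous_image continuous_on_remainder_integrand) auto
  then obtain B where B: "B > 0" "\<And>z. z \<in> cball 0 1 \<Longrightarrow> norm (remainder_integrand t z) \<le> B"
    using compact_imp_bounded bounded_pos by (metis imageI)
  have D: "(remainder t has_field_derivative remainder_integrand t z) (at z within ball 0 1)" if z: "z \<in> ball 0 1" for z
  proof -
    have "((\<lambda>z. elliptic_E t z - corner_factor t z * csqrt (quartic t z)) has_field_derivative
        1 / csqrt (quartic t z) - (1 / csqrt (quartic t z) - remainder_integrand t z)) (at z within ball 0 1)"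
      by (intro DERIV_diff has_field_derivative_at_within[OF has_field_derivative_elliptic_E]
        has_field_derivative_at_within[OF corner_factor_derivative] z s)
    thus ?thesis
      by (rule has_field_derivative_transform_within[OF _ zero_less_one z, THEN DERIV_cong])
         (auto simp: elliptic_E_decomposition s)
  qed
  have "norm (remainder t x - remainder t y) \<le> B * norm (x - y)" if "x \<in> cball 0 1" "y \<in> cball 0 1" for x y
    by (rule field_differentiable_bound_closure[of "ball 0 1", OF _ D])
       (use B that in \<open>auto simp: continuous_on_remainder\<close>)
  thus ?thesis by (rule that)
qed

section \<open>Injectivity, strict bounds and differentiability at the boundary\<close>

text \<open>The Noshiro-Warschawski criterion. Along the segment from \<open>w\<close> to
  \<open>z\<close>, dividing by the direction \<open>z - w\<close> turns the derivative into that of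
  \<open>f\<close>, so the real part strictly increases.\<close>

lemma inj_on_Re_deriv_pos:
  assumes S: "convex S" and df: "\<And>z. z \<in> S \<Longrightarrow> (f has_field_derivative f' z) (at z)"
    and pos: "\<And>z. z \<in> S \<Longrightarrow> Re (f' z) > 0"
  shows "inj_on f S"
proof (rule inj_onI, rule ccontr)
  fix z w assume zw: "z \<in> S" "w \<in> S" "f z = f w" "z \<noteq> w"
  define \<phi> where "\<phi> = (\<lambda>x. Re (f (w + of_real x * (z - w)) / (z - w)))"
  have D: "(\<phi> has_real_derivative Re (f' (w + of_real x * (z - w)))) (at x)" if x: "0 \<le> x" "x \<le> 1" for x
  proof -
    have "w + of_real x * (z - w) = (1 - x) *\<^sub>R w + x *\<^sub>R z"
      by (simp add: algebra_simps scaleR_conv_of_real)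
    hence "w + of_real x * (z - w) \<in> S"
      using S x zw by (simp add: convex_alt)
    hence "((\<lambda>u. f (w + u * (z - w)) / (z - w)) has_field_derivative
        f' (w + of_real x * (z - w))) (at (of_real x))"
      using zw by (auto intro!: derivative_eq_intros DERIV_chain2[OF df])
    hence "((\<lambda>x. f (w + of_real x * (z - w)) / (z - w)) has_vector_derivative f' (w + of_real x * (z - w))) (at x)"
      by (rule has_vector_derivative_real_field)
    thus ?thesis unfolding \<phi>_def has_real_derivative_iff_has_vector_derivative
      by (rule bounded_linear.has_vector_derivative[OF bounded_linear_Re])
  qed
  have "\<phi> 0 < \<phi> 1"
  proof (rule DERIV_pos_imp_increasing[where f = \<phi>])
    fix x :: real assume x: "0 \<le> x" "x \<le> 1"
    have "w + of_real x * (z - w) = (1 - x) *\<^sub>R w + x *\<^sub>R z"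
      by (simp add: algebra_simps scaleR_conv_of_real)
    hence "w + of_real x * (z - w) \<in> S"
      using S x zw by (simp add: convex_alt)
    with D[OF x] pos show "\<exists>y. (\<phi> has_real_derivative y) (at x) \<and> y > 0" by blast
  qed simp
  thus False using zw by (simp add: \<phi>_def)
qed

text \<open>The maximum principle gives the weak inequality; equality inside would contradict
  openness of the image.\<close>

lemma Re_less_frontier:
  assumes holf: "f holomorphic_on ball 0 1" and inj: "inj_on f (ball 0 1)"
    and cont: "continuous_on (cball 0 1) f"
    and le: "\<And>z. norm z = 1 \<Longrightarrow> Re (f z) \<le> B" and z: "z \<in> ball 0 1"
  shows "Re (f z) < B"
proof -
  have le': "Re (f w) \<le> B" if "w \<in> ball 0 1" for w
    by (rule maximum_real_frontier[of f "ball 0 1"]) (use assms that in auto)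
  have "open (f ` ball 0 1)"
    by (intro open_mapping_thm3 holf inj) auto
  then obtain e where e: "e > 0" "ball (f z) e \<subseteq> f ` ball 0 1"
    using z by (meson imageI openE)
  have "f z + of_real (e / 2) \<in> ball (f z) e" using e by (simp add: dist_norm)
  then obtain w where "w \<in> ball 0 1" "f w = f z + of_real (e / 2)" using e by (metis image_iff subsetD)
  with le'[of w] e show ?thesis by simp
qed

lemma inj_on_elliptic_E: "inj_on (elliptic_E t) (ball 0 1)"
proof (rule inj_on_Re_deriv_pos[OF convex_ball has_field_derivative_elliptic_E])
  fix z :: complex assume z: "z \<in> ball 0 1"
  have "Re (csqrt (quartic t z)) > 0"
    by (intro Re_csqrt_pos quartic_notin_nonpos_Reals z)
  thus "Re (1 / csqrt (quartic t z)) > 0"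
    by (auto simp: Re_divide intro!: divide_pos_pos add_pos_nonneg)
qed

text \<open>Off the corners the integrand continues holomorphically across the circle. A local
  primitive there differs from \<open>elliptic_E\<close> by a constant inside the disk and, by
  continuity, also on the circle.\<close>

lemma has_field_derivative_elliptic_E_cball:
  assumes s: "sin (2*t) \<noteq> 0" and z: "z \<in> cball 0 1" "quartic t z \<noteq> 0"
  shows "(elliptic_E t has_field_derivative 1 / csqrt (quartic t z)) (at z within cball 0 1)"
proof -
  let ?U = "quartic t -` (- \<real>\<^sub>\<le>\<^sub>0)"
  have "open ?U"
    using continuous_on_quartic[of UNIV "\<lambda>z. z" t] by (intro open_vimage) (auto simp: open_Compl)
  moreover have "z \<in> ?U" using quartic_nonpos_Reals_imp_0 z by auto
  ultimately obtain d where d: "d > 0" "ball z d \<subseteq> ?U" by (meson openE)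
  have "(\<lambda>u. 1 / csqrt (quartic t u)) holomorphic_on ball z d"
    using d by (auto intro!: holomorphic_intros holomorphic_on_csqrt')
  then obtain P where P: "\<And>u. u \<in> ball z d \<Longrightarrow> (P has_field_derivative 1 / csqrt (quartic t u)) (at u within ball z d)"
    using holomorphic_convex_primitive'[of "ball z d"] by (metis convex_ball open_ball)
  have P: "(P has_field_derivative 1 / csqrt (quartic t u)) (at u)" if "u \<in> ball z d" for u
    using P[OF that] by (simp add: at_within_open[OF that])
  \<comment> \<open>Halving the radius keeps the closure of \<open>S\<close> inside the domain of
    \<open>P\<close>; as an intersection of two disks, \<open>S\<close> is convex.\<close>
  define S where "S = ball z (d/2) \<inter> ball 0 1"
  have contP: "continuous_on (ball z d) P"
    using P by (auto intro!: continuous_at_imp_continuous_on DERIV_isCont)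
  have "\<exists>k. \<forall>u\<in>S. elliptic_E t u - P u = k"
  proof (rule has_field_derivative_zero_constant)
    fix u assume u: "u \<in> S"
    hence "u \<in> ball z d" "u \<in> ball 0 1" using d by (auto simp: S_def)
    from DERIV_diff[OF has_field_derivative_elliptic_E[OF this(2), of t] P[OF this(1)]]
    show "((\<lambda>u. elliptic_E t u - P u) has_field_derivative 0) (at u within S)"
      by (simp add: has_field_derivative_at_within)
  qed (auto simp: S_def intro!: convex_Int)
  then obtain k where k: "\<And>u. u \<in> S \<Longrightarrow> elliptic_E t u - P u = k" by blast
  have k': "elliptic_E t u - P u = k" if "u \<in> ball z (d/2) \<inter> cball 0 1" for u
  proof (rule continuous_constant_on_closure[of S "\<lambda>u. elliptic_E t u - P u"])
    have sub: "closure S \<subseteq> cball z (d/2) \<inter> cball 0 1"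
      unfolding S_def by (intro closure_minimal) auto
    moreover have "cball z (d/2) \<subseteq> ball z d" using d by auto
    ultimately show "continuous_on (closure S) (\<lambda>u. elliptic_E t u - P u)"
      by (intro continuous_intros continuous_on_subset[OF continuous_on_elliptic_E[OF s]]
            continuous_on_subset[OF contP]) auto
    have "ball z (d/2) \<inter> closure (ball 0 1) \<subseteq> closure S"
      unfolding S_def by (rule open_Int_closure_subset) auto
    thus "u \<in> closure S" using that by auto
  qed (use k in auto)
  have "((\<lambda>u. P u + k) has_field_derivative 1 / csqrt (quartic t z)) (at z within cball 0 1)"
    using d by (auto intro!: derivative_eq_intros has_field_derivative_at_within[OF P])
  thus ?thesis
  proof (rule has_field_derivative_transform_within)
    show "P u + k = elliptic_E t u" if "u \<in> cball 0 1" "dist u z < d/2" for u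
      using k'[of u] that by (auto simp: dist_commute)
  qed (use d z in auto)
qed

section \<open>The image of the circle under the elliptic integral\<close>

text \<open>The quartic is palindromic, so dividing by the square of a unit number leaves a real
  value. The sign of this value decides whether an arc goes to a vertical or a horizontal
  side.\<close>

lemma quartic_cis: "quartic t (cis x) = cis (2 * x) * of_real (4 * sin (t + x) * sin (t - x))"
proof -
  have "(cis x)^4 = cis (2*x) * cis (2*x)" by (simp add: Complex.DeMoivre cis_mult)
  moreover have "(cis x)^2 = cis (2*x)" by (simp add: Complex.DeMoivre)
  moreover have "1 = cis (2*x) * cis (-(2*x))" by (simp add: cis_mult)
  ultimately have "quartic t (cis x) = cis (2*x) * (cis (2*x) + cis (-(2*x)) - 2 * of_real (cos (2*t)))"
    unfolding quartic_def by (simp add: algebra_simps)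
  also have "cis (2*x) + cis (-(2*x)) - 2 * of_real (cos (2*t)) = of_real (2 * (cos (2*x) - cos (2*t)))"
    by (simp add: complex_eq_iff)
  also have "cos (2*x) - cos (2*t) = 2 * (sin (t + x) * sin (t - x))"
  proof -
    have "(2*x + 2*t) / 2 = t + x" "(2*t - 2*x) / 2 = t - x" by simp_all
    thus ?thesis by (simp only: cos_diff_cos mult.assoc)
  qed
  finally show ?thesis by (simp add: mult_ac)
qed

locale quartic_angle =
  fixes t :: real
  assumes t: "0 < t" "t < pi / 2"
begin

abbreviation "E \<equiv> elliptic_E t"
abbreviation "Q \<equiv> quartic t"

lemma sin_2t: "sin (2*t) > 0" using t by (intro sin_gt_zero) auto

lemma sin_2t_nz [simp]: "sin (2*t) \<noteq> 0" using sin_2t by simp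

lemma E_cis_vector_derivative:
  assumes "Q (cis x) \<noteq> 0"
  shows "((\<lambda>x. E (cis x)) has_vector_derivative \<i> * cis x / csqrt (Q (cis x))) (at x)"
proof -
  have "(E has_field_derivative 1 / csqrt (Q (cis x))) (at (cis x) within range cis)"
    by (rule has_field_derivative_subset[OF has_field_derivative_elliptic_E_cball[OF sin_2t_nz]])
       (use assms in auto)
  moreover have "(cis has_vector_derivative \<i> * cis x) (at x)"
    unfolding cis_conv_exp[abs_def]
    by (rule has_vector_derivative_real_field) (auto intro!: derivative_eq_intros)
  ultimately have "(E \<circ> cis has_vector_derivative (\<i> * cis x) * (1 / csqrt (Q (cis x)))) (at x within UNIV)"
    by (intro field_vector_diff_chain_within) auto
  thus ?thesis by (simp add: o_def)
qed

lemma continuous_on_E_cis: "continuous_on A (\<lambda>x. E (cis x))"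
  by (rule continuous_on_compose2[OF continuous_on_elliptic_E[OF sin_2t_nz]])
     (auto intro!: continuous_intros)

text \<open>The principal root is \<open>cis x * r\<close> with \<open>r > 0\<close>, selected by
  \<open>cos x > 0\<close>. The tangent \<open>\<i> / r\<close> therefore points straight
  up.\<close>

lemma E_cis_right:
  assumes "-t < x" "x < t"
  shows "((\<lambda>x. Re (E (cis x))) has_real_derivative 0) (at x)"
    "\<exists>y. ((\<lambda>x. Im (E (cis x))) has_real_derivative y) (at x) \<and> y > 0"
proof -
  define r where "r = sqrt (4 * sin (t + x) * sin (t - x))"
  have sin: "sin (t + x) > 0" "sin (t - x) > 0"
    using assms t by (auto intro!: sin_gt_zero)
  hence r: "r > 0" "r^2 = 4 * sin (t + x) * sin (t - x)" by (auto simp: r_def)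
  have "csqrt (Q (cis x)) = cis x * of_real r"
  proof (rule csqrt_unique)
    show "(cis x * of_real r)^2 = Q (cis x)"
      unfolding quartic_cis r(2)[symmetric] by (simp add: power_mult_distrib Complex.DeMoivre)
    show "0 < Re (cis x * of_real r) \<or> Re (cis x * of_real r) = 0 \<and> 0 \<le> Im (cis x * of_real r)"
      using r assms t by (auto intro!: mult_pos_pos cos_gt_zero_pi)
  qed
  hence eq: "\<i> * cis x / csqrt (Q (cis x)) = \<i> * of_real (1 / r)"
    using r by simp
  have "Q (cis x) \<noteq> 0" unfolding quartic_cis using sin by simp
  note D = E_cis_vector_derivative[OF this, unfolded eq]
  show "((\<lambda>x. Re (E (cis x))) has_real_derivative 0) (at x)"
    unfolding has_real_derivative_iff_has_vector_derivative
    using bounded_linear.has_vector_derivative[OF bounded_linear_Re D] by simp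
  have "((\<lambda>x. Im (E (cis x))) has_real_derivative 1 / r) (at x)"
    unfolding has_real_derivative_iff_has_vector_derivative
    using bounded_linear.has_vector_derivative[OF bounded_linear_Im D] by simp
  thus "\<exists>y. ((\<lambda>x. Im (E (cis x))) has_real_derivative y) (at x) \<and> y > 0" using r by fastforce
qed

text \<open>The sine product is now negative and the principal root is
  \<open>- \<i> * cis x * r\<close>, selected by \<open>sin x > 0\<close>. The tangent
  \<open>- 1 / r\<close> points to the left.\<close>

lemma E_cis_top:
  assumes "t < x" "x < pi - t"
  shows "((\<lambda>x. Im (E (cis x))) has_real_derivative 0) (at x)"
    "\<exists>y. ((\<lambda>x. Re (E (cis x))) has_real_derivative y) (at x) \<and> y < 0"
proof -
  define r where "r = sqrt (4 * sin (t + x) * sin (x - t))"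
  have pos: "4 * sin (t + x) * sin (x - t) > 0"
    using assms t by (intro mult_pos_pos sin_gt_zero) auto
  hence r: "r > 0" "r^2 = 4 * sin (t + x) * sin (x - t)" by (auto simp: r_def)
  have neg: "4 * sin (t + x) * sin (t - x) = - (r^2)"
    using sin_minus[of "x - t"] by (simp add: r)
  have "csqrt (Q (cis x)) = - \<i> * cis x * of_real r"
  proof (rule csqrt_unique)
    show "(- \<i> * cis x * of_real r)^2 = Q (cis x)"
      unfolding quartic_cis neg by (simp add: power_mult_distrib Complex.DeMoivre)
    show "0 < Re (- \<i> * cis x * of_real r) \<or> Re (- \<i> * cis x * of_real r) = 0 \<and> 0 \<le> Im (- \<i> * cis x * of_real r)"
      using r assms t by (auto intro!: mult_pos_pos sin_gt_zero)
  qed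
  hence eq: "\<i> * cis x / csqrt (Q (cis x)) = of_real (- 1 / r)"
    using r by (simp add: field_simps)
  have "Q (cis x) \<noteq> 0" unfolding quartic_cis neg using r(1) by simp
  note D = E_cis_vector_derivative[OF this, unfolded eq]
  show "((\<lambda>x. Im (E (cis x))) has_real_derivative 0) (at x)"
    unfolding has_real_derivative_iff_has_vector_derivative
    using bounded_linear.has_vector_derivative[OF bounded_linear_Im D] by simp
  have "((\<lambda>x. Re (E (cis x))) has_real_derivative -1 / r) (at x)"
    unfolding has_real_derivative_iff_has_vector_derivative
    using bounded_linear.has_vector_derivative[OF bounded_linear_Re D] by simp
  moreover have "- 1 / r < 0" using r by simp
  ultimately show "\<exists>y. ((\<lambda>x. Re (E (cis x))) has_real_derivative y) (at x) \<and> y < 0" by blast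
qed

lemma Re_E_right:
  assumes "-t \<le> x" "x \<le> t" shows "Re (E (cis x)) = Re (omega1 t)"
proof -
  have "Re (E (cis y)) = Re (E (cis (-t)))" if "-t \<le> y" "y \<le> t" for y
    using t that by (intro DERIV_isconst2[where b = t and f = "\<lambda>x. Re (E (cis x))"] continuous_intros continuous_on_E_cis E_cis_right) auto
  from this[OF assms] this[of 0] show ?thesis using t by (simp add: omega1_def)
qed

lemma Im_E_right:
  assumes "-t \<le> x" "x < y" "y \<le> t" shows "Im (E (cis x)) < Im (E (cis y))"
  using assms by (intro DERIV_pos_imp_increasing_open[where f = "\<lambda>x. Im (E (cis x))"] continuous_intros continuous_on_E_cis E_cis_right) auto

lemma Im_E_top:
  assumes "t \<le> x" "x \<le> pi - t" shows "Im (E (cis x)) = Im (omega2 t)"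
proof -
  have "Im (E (cis y)) = Im (E (cis t))" if "t \<le> y" "y \<le> pi - t" for y
    using t that by (intro DERIV_isconst2[where b = "pi - t" and f = "\<lambda>x. Im (E (cis x))"] continuous_intros continuous_on_E_cis E_cis_top) auto
  from this[OF assms] this[of "pi/2"] show ?thesis using t by (simp add: omega2_def)
qed

lemma Re_E_top:
  assumes "t \<le> x" "x < y" "y \<le> pi - t" shows "Re (E (cis y)) < Re (E (cis x))"
  using assms by (intro DERIV_neg_imp_decreasing_open[where f = "\<lambda>x. Re (E (cis x))"] continuous_intros continuous_on_E_cis E_cis_top) auto

lemma Im_omega1: "Im (omega1 t) = 0"
  using elliptic_E_cnj[of 1 t] by (simp add: omega1_def complex_eq_iff)

lemma Re_omega2: "Re (omega2 t) = 0"
  using elliptic_E_cnj[of \<i> t] elliptic_E_uminus[of t \<i>] by (simp add: omega2_def complex_eq_iff)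

lemma E_cis_t: "E (cis t) = omega3 t"
  using Re_E_right[of t] Im_E_top[of t] t
  by (simp add: omega3_def complex_eq_iff Im_omega1 Re_omega2)

lemma E_cis_minus_t: "E (cis (-t)) = cnj (omega3 t)"
  using elliptic_E_cnj[of "cis t" t] by (simp add: E_cis_t cis_cnj)

lemma E_cis_pi_minus_t: "E (cis (pi - t)) = - cnj (omega3 t)"
proof -
  have "cis (pi - t) = - cis (-t)" by (simp add: complex_eq_iff)
  thus ?thesis by (simp only: elliptic_E_uminus E_cis_minus_t)
qed

lemma Re_omega3: "Re (omega3 t) = Re (omega1 t)" and Im_omega3: "Im (omega3 t) = Im (omega2 t)"
  by (simp_all add: omega3_def Im_omega1 Re_omega2)

text \<open>These are half the lengths of the top and right sides, each of which is traversed
  strictly monotonically.\<close>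

lemma omega_pos: "Re (omega1 t) > 0" "Im (omega2 t) > 0"
  using Re_E_top[of t "pi - t"] Im_E_right[of "-t" t] t
  by (simp_all add: E_cis_t E_cis_minus_t E_cis_pi_minus_t Re_omega3 Im_omega3)

lemma sphere_cases:
  assumes "norm z = 1"
  obtains x where "z = cis x \<or> z = - cis x" "-t \<le> x \<and> x \<le> t \<or> t \<le> x \<and> x \<le> pi - t"
proof -
  define a where "a = Arg z"
  have z: "z = cis a" proof -
    have "z \<noteq> 0" using assms by auto
    with assms cis_Arg[of z] show ?thesis by (simp add: a_def sgn_div_norm)
  qed
  have a: "-pi < a" "a \<le> pi" by (auto simp: a_def Arg_bounded)
  have m: "cis (a - pi) = - cis a" "cis (a + pi) = - cis a" by (auto simp: complex_eq_iff)
  consider "a < -t" | "-t \<le> a" "a \<le> pi - t" | "a > pi - t" by linarith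
  thus ?thesis
  proof cases
    case 1
    hence "-t \<le> a + pi \<and> a + pi \<le> t \<or> t \<le> a + pi \<and> a + pi \<le> pi - t" using a t by linarith
    thus ?thesis using m z by (intro that[of "a + pi"]) auto
  next
    case 2 thus ?thesis using z by (intro that[of a]) auto
  next
    case 3
    hence "-t \<le> a - pi \<and> a - pi \<le> t" using a t by linarith
    thus ?thesis using m z by (intro that[of "a - pi"]) auto
  qed
qed

text \<open>The strict inequalities off the corners are what later keep
  \<open>E z + omega3 t\<close> away from the poles on the open sides.\<close>

lemma E_sphere:
  assumes "norm z = 1"
  shows "\<bar>Re (E z)\<bar> = Re (omega1 t) \<and> \<bar>Im (E z)\<bar> \<le> Im (omega2 t) \<and> (Q z \<noteq> 0 \<longrightarrow> \<bar>Im (E z)\<bar> < Im (omega2 t)) \<or>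
         \<bar>Im (E z)\<bar> = Im (omega2 t) \<and> \<bar>Re (E z)\<bar> \<le> Re (omega1 t) \<and> (Q z \<noteq> 0 \<longrightarrow> \<bar>Re (E z)\<bar> < Re (omega1 t))"
    (is "?P z")
proof -
  have corner: "Q (cis t) = 0" "Q (cis (-t)) = 0" "Q (cis (pi - t)) = 0"
    by (simp_all add: quartic_cis)
  have "?P (cis x)" if x: "-t \<le> x \<and> x \<le> t \<or> t \<le> x \<and> x \<le> pi - t" for x
    using x
  proof
    assume x: "-t \<le> x \<and> x \<le> t"
    have "-t = x \<or> Im (E (cis (-t))) < Im (E (cis x))" "x = t \<or> Im (E (cis x)) < Im (E (cis t))"
      using Im_E_right[of "-t" x] Im_E_right[of x t] x by force+
    hence "\<bar>Im (E (cis x))\<bar> \<le> Im (omega2 t) \<and> (Q (cis x) \<noteq> 0 \<longrightarrow> \<bar>Im (E (cis x))\<bar> < Im (omega2 t))"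
      using omega_pos corner E_cis_t E_cis_minus_t Im_omega3 by (elim disjE) auto
    with Re_E_right[of x] x omega_pos show ?thesis by auto
  next
    assume x: "t \<le> x \<and> x \<le> pi - t"
    have v: "Re (E (cis t)) = Re (omega1 t)" "Re (E (cis (pi - t))) = - Re (omega1 t)"
      by (simp_all only: E_cis_t E_cis_pi_minus_t Re_omega3 uminus_complex.sel cnj.sel)
    have "Re (E (cis x)) \<le> Re (omega1 t) \<and> (Q (cis x) \<noteq> 0 \<longrightarrow> Re (E (cis x)) < Re (omega1 t))"
      using v(1) corner(1) Re_E_top[of t x] x by (cases "x = t") auto
    moreover have "- Re (omega1 t) \<le> Re (E (cis x)) \<and> (Q (cis x) \<noteq> 0 \<longrightarrow> - Re (omega1 t) < Re (E (cis x)))"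
      using v(2) corner(3) Re_E_top[of x "pi - t"] x by (cases "x = pi - t") auto
    ultimately have "\<bar>Re (E (cis x))\<bar> \<le> Re (omega1 t) \<and> (Q (cis x) \<noteq> 0 \<longrightarrow> \<bar>Re (E (cis x))\<bar> < Re (omega1 t))"
      by (auto simp: abs_le_iff abs_less_iff)
    with Im_E_top[of x] x omega_pos show ?thesis by auto
  qed
  moreover have "?P (- z) \<longleftrightarrow> ?P z" for z
    by (simp add: elliptic_E_uminus)
  ultimately show ?thesis
  proof -
    assume P: "\<And>x. -t \<le> x \<and> x \<le> t \<or> t \<le> x \<and> x \<le> pi - t \<Longrightarrow> ?P (cis x)"
      and minus: "\<And>z. ?P (- z) \<longleftrightarrow> ?P z"
    obtain x where x: "z = cis x \<or> z = - cis x" and "-t \<le> x \<and> x \<le> t \<or> t \<le> x \<and> x \<le> pi - t"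
      by (rule sphere_cases[OF assms])
    hence cis: "?P (cis x)" by (intro P)
    from x show ?thesis
    proof
      assume "z = cis x"
      thus ?thesis using cis by (rule ssubst)
    next
      assume "z = - cis x"
      thus ?thesis using minus[THEN iffD2, OF cis] by (rule ssubst)
    qed
  qed
qed

lemma E_ball:
  assumes "z \<in> ball 0 1"
  shows "\<bar>Re (E z)\<bar> < Re (omega1 t)" "\<bar>Im (E z)\<bar> < Im (omega2 t)"
proof -
  have sphere: "\<bar>Re (E w)\<bar> \<le> Re (omega1 t)" "\<bar>Im (E w)\<bar> \<le> Im (omega2 t)" if "norm w = 1" for w
    using E_sphere[OF that] by auto
  \<comment> \<open>Rotation by 1, -1, \<open>-\<i>\<close> and \<open>\<i>\<close> turns each of
    the four sides into a bound on a real part.\<close>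
  have "Re (c * E z) < B" if "c \<noteq> 0" "\<And>w. norm w = 1 \<Longrightarrow> Re (c * E w) \<le> B" for c B
    by (rule Re_less_frontier[of "\<lambda>z. c * E z"])
       (use that assms inj_on_elliptic_E[of t] in \<open>auto intro!: holomorphic_intros holomorphic_elliptic_E
          continuous_intros continuous_on_elliptic_E simp: inj_on_def\<close>)
  from this[of 1 "Re (omega1 t)"] this[of "-1" "Re (omega1 t)"] this[of "-\<i>" "Im (omega2 t)"] this[of "\<i>" "Im (omega2 t)"]
  show "\<bar>Re (E z)\<bar> < Re (omega1 t)" "\<bar>Im (E z)\<bar> < Im (omega2 t)"
    using sphere by (simp_all add: abs_le_iff abs_less_iff minus_le_iff)
qed

section \<open>Asymptotics at the corners\<close>

text \<open>At a corner \<open>p^2 - c\<close> is plus or minus \<open>\<i> * s\<close>, so Q'(p)^2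
  = -16 s^2 p^2, while \<open>corner_factor t p\<close> is 2 / Q'(p). The factor \<open>p^2\<close>
  makes the constant the same for all four corners.\<close>

lemma corner_factor_sq:
  assumes "Q p = 0"
  shows "corner_factor t p ^ 2 * p^2 * (- 4 * of_real (sin (2*t))^2) = 1"
proof -
  define c s :: complex where "c = of_real (cos (2*t))" and "s = of_real (sin (2*t))"
  have cs: "c^2 + s^2 = 1" unfolding c_def s_def by (simp flip: of_real_power of_real_add)
  have s: "s \<noteq> 0" by (simp add: s_def)
  have p: "p^4 - 2 * c * p^2 + 1 = 0" using assms by (simp add: quartic_def c_def)
  have "(p * (c * (p^2 - c) + s^2))^2 * p^2 = - (s^2)"
    using p cs by algebra
  thus ?thesis
    unfolding corner_factor_def c_def[symmetric] s_def[symmetric]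
    using s by (simp add: divide_simps power_mult_distrib)
qed

text \<open>After division by \<open>csqrt (Q z)\<close> the increment of the remainder vanishes in
  the limit and only the corner factor survives. Squaring makes the branch of the root
  disappear.\<close>

lemma E_corner_asymp:
  assumes p: "p \<in> cball 0 1" "Q p = 0"
  shows "((\<lambda>z. Q z / (z^2 * (E z - E p)^2)) \<longlongrightarrow> - 4 * of_real (sin (2*t))^2) (at p within cball 0 1)"
proof -
  let ?F = "at p within cball 0 1"
  have p0: "p \<noteq> 0" using p by auto
  have cf0: "corner_factor t p \<noteq> 0" using corner_factor_sq[OF p(2)] by auto
  obtain B where B: "\<And>x y. x \<in> cball 0 1 \<Longrightarrow> y \<in> cball 0 1 \<Longrightarrow> norm (remainder t x - remainder t y) \<le> B * norm (x - y)"
    using remainder_lipschitz[OF sin_2t_nz] by blast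
  define q where "q = 4 * p^3 - 4 * of_real (cos (2*t)) * p"
  have q0: "q \<noteq> 0"
  proof
    assume "q = 0"
    hence "p^2 = of_real (cos (2*t))" using p0 by (simp add: q_def power3_eq_cube power2_eq_square)
    moreover have "p^4 = (p^2)^2" by simp
    ultimately have "1 - (of_real (cos (2*t)))^2 = (0::complex)"
      using p(2) by (simp add: quartic_def power2_eq_square)
    hence "complex_of_real (1 - (cos (2*t))^2) = 0" by simp
    hence "1 - (cos (2*t))^2 = 0" by (simp only: of_real_eq_0_iff)
    thus False using sin_2t_nz by (simp add: sin_squared_eq[symmetric])
  qed
  have "(Q has_field_derivative q) ?F"
    using has_field_derivative_quartic[of "\<lambda>z. z" 1 p "cball 0 1" t] by (simp add: q_def)
  hence lim: "((\<lambda>z. Q z / (z - p)) \<longlongrightarrow> q) ?F"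
    by (simp add: has_field_derivative_iff p)
  have nz: "\<forall>\<^sub>F z in ?F. Q z \<noteq> 0"
    using tendsto_imp_eventually_ne[OF lim q0] by eventually_elim auto
  \<comment> \<open>Since the zero of Q is simple, this quotient, which is
    \<open>(z - p)^2 / Q z\<close>, tends to 0; its square root compares the distance with
    \<open>csqrt (Q z)\<close>.\<close>
  have "((\<lambda>z. (z - p) / (Q z / (z - p))) \<longlongrightarrow> (p - p) / q) ?F"
    by (intro tendsto_intros lim q0)
  hence "((\<lambda>z. sqrt (norm ((z - p)^2 / Q z))) \<longlongrightarrow> sqrt (norm (0::complex))) ?F"
    by (intro tendsto_intros) (simp add: power2_eq_square)
  hence "((\<lambda>z. B * sqrt (norm ((z - p)^2 / Q z))) \<longlongrightarrow> 0) ?F"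
    by (intro tendsto_mult_right_zero) simp
  hence R: "((\<lambda>z. (remainder t z - remainder t p) / csqrt (Q z)) \<longlongrightarrow> 0) ?F"
  proof (rule Lim_null_comparison[rotated])
    have "\<forall>\<^sub>F z in ?F. z \<in> cball 0 1" by (auto simp: eventually_at_filter)
    thus "\<forall>\<^sub>F z in ?F. norm ((remainder t z - remainder t p) / csqrt (Q z)) \<le> B * sqrt (norm ((z - p)^2 / Q z))"
    proof eventually_elim
      case (elim z)
      have "norm ((remainder t z - remainder t p) / csqrt (Q z)) \<le> B * norm (z - p) / sqrt (norm (Q z))"
        unfolding norm_divide norm_csqrt using B[OF elim p(1)] by (rule divide_right_mono) auto
      thus ?case by (simp add: norm_divide norm_power real_sqrt_divide)
    qed
  qed
  have cf: "(corner_factor t \<longlongrightarrow> corner_factor t p) ?F"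
    using continuous_on_corner_factor[of "cball 0 1" t] p by (auto simp: continuous_on_def)
  have "((\<lambda>z. (remainder t z - remainder t p) / csqrt (Q z) + corner_factor t z) \<longlongrightarrow> 0 + corner_factor t p) ?F"
    by (intro tendsto_intros R cf)
  hence "((\<lambda>z. 1 / (z^2 * ((remainder t z - remainder t p) / csqrt (Q z) + corner_factor t z)^2)) \<longlongrightarrow>
      1 / (p^2 * (0 + corner_factor t p)^2)) ?F"
    using p0 cf0 by (intro tendsto_intros R cf) auto
  moreover have "1 / (p^2 * (0 + corner_factor t p)^2) = - 4 * of_real (sin (2*t))^2"
    using corner_factor_sq[OF p(2)] p0 cf0 by (simp add: field_simps)
  moreover have "\<forall>\<^sub>F z in ?F. 1 / (z^2 * ((remainder t z - remainder t p) / csqrt (Q z) + corner_factor t z)^2)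
      = Q z / (z^2 * (E z - E p)^2)"
  proof -
    have "\<forall>\<^sub>F z in ?F. z \<in> cball 0 1" by (auto simp: eventually_at_filter)
    with nz show ?thesis
    proof eventually_elim
      case (elim z)
      have "E z - E p = csqrt (Q z) * ((remainder t z - remainder t p) / csqrt (Q z) + corner_factor t z)"
      proof -
        have "E z = remainder t z + corner_factor t z * csqrt (Q z)" "E p = remainder t p"
          using elim p by (simp_all add: elliptic_E_decomposition)
        thus ?thesis using elim by (simp add: distrib_left mult.commute)
      qed
      hence "(E z - E p)^2 = Q z * ((remainder t z - remainder t p) / csqrt (Q z) + corner_factor t z)^2"
        by (simp add: power_mult_distrib)
      thus ?case using elim by simp
    qed
  qed
  ultimately show ?thesis by (simp add: tendsto_cong)
qed

end

subsection \<open>The Weierstrass function along the elliptic integral\<close>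

text \<open>Evenness kills the first derivative at 0, so the removable-singularity quotient can be
  taken twice.\<close>

lemma even_holomorphic_factor:
  assumes holf: "f holomorphic_on ball 0 1" and even: "\<And>z. z \<in> ball 0 1 \<Longrightarrow> f (- z) = f z"
  obtains g where "g holomorphic_on ball 0 1" "\<And>z. z \<in> ball 0 1 \<Longrightarrow> f z = f 0 + z^2 * g z"
proof -
  define f1 where "f1 = (\<lambda>z. if z = 0 then deriv f 0 else (f z - f 0) / (z - 0))"
  define f2 where "f2 = (\<lambda>z. if z = 0 then deriv f1 0 else (f1 z - f1 0) / (z - 0))"
  have f1: "f1 holomorphic_on ball 0 1"
    unfolding f1_def by (rule pole_lemma_open[OF holf]) auto
  have f2: "f2 holomorphic_on ball 0 1"
    unfolding f2_def by (rule pole_lemma_open[OF f1]) auto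
  have D: "(f has_field_derivative deriv f 0) (at 0)"
    by (rule holomorphic_derivI[OF holf]) auto
  have "((\<lambda>z. f (- z)) has_field_derivative deriv f 0 * (-1)) (at 0)"
    by (rule DERIV_chain2[where g = uminus]) (use D in \<open>auto intro!: derivative_eq_intros\<close>)
  hence "(f has_field_derivative deriv f 0 * (-1)) (at 0)"
    by (rule has_field_derivative_transform_within[where d = 1]) (use even in auto)
  with D have "deriv f 0 = deriv f 0 * (-1)" by (rule DERIV_unique)
  hence "f1 0 = 0" by (simp add: f1_def)
  hence "f z = f 0 + z^2 * f2 z" for z
    by (simp add: f2_def f1_def power2_eq_square)
  with f2 show ?thesis by (rule that)
qed

text \<open>The maximum principle for \<open>\<i> * f\<close> and \<open>- \<i> * f\<close> makes
  \<open>f\<close> real inside, and a real-valued image cannot be open.\<close>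

lemma Im_zero_on_sphere_imp_constant:
  assumes holf: "f holomorphic_on ball 0 1" and cont: "continuous_on (cball 0 1) f"
    and Im0: "\<And>z. norm z = 1 \<Longrightarrow> Im (f z) = 0"
  obtains k where "\<And>z. z \<in> cball 0 1 \<Longrightarrow> f z = k"
proof -
  have le: "Re (c * f z) \<le> 0" if "c = \<i> \<or> c = - \<i>" "z \<in> ball 0 1" for c z
    by (rule maximum_real_frontier[of "\<lambda>z. c * f z" "ball 0 1"])
       (use that assms in \<open>auto intro!: holomorphic_intros continuous_intros\<close>)
  have Im: "Im (f z) = 0" if "z \<in> ball 0 1" for z
    using le[of \<i> z] le[of "-\<i>" z] that by simp
  have "f constant_on ball 0 1"
  proof (rule ccontr)
    assume "\<not> f constant_on ball 0 1"
    hence "open (f ` ball 0 1)"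
      by (intro open_mapping_thm[OF holf]) auto
    then obtain e where e: "e > 0" "ball (f 0) e \<subseteq> f ` ball 0 1"
      by (metis centre_in_ball imageI openE zero_less_one)
    have "f 0 + \<i> * of_real (e / 2) \<in> ball (f 0) e" using e by (simp add: dist_norm norm_mult)
    then obtain w where "w \<in> ball 0 1" "f w = f 0 + \<i> * of_real (e / 2)" using e by (metis image_iff subsetD)
    with Im[of w] Im[of 0] e show False by simp
  qed
  then obtain k where k: "\<And>z. z \<in> ball 0 1 \<Longrightarrow> f z = k" unfolding constant_on_def by blast
  have "f z = k" if "z \<in> cball 0 1" for z
    by (rule continuous_constant_on_closure[of "ball 0 1" f]) (use cont k that in auto)
  thus ?thesis by (rule that)
qed

section \<open>The Weierstrass function pulled back to the disk\<close>

context quartic_angle begin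

sublocale lattice_basis "2 * omega1 t" "2 * omega2 t"
  by unfold_locales (use omega_pos in \<open>simp add: Im_omega1 Re_omega2\<close>)

abbreviation "wp \<equiv> weierstrass_p (2 * omega1 t) (2 * omega2 t)"

lemma lattice_iff:
  "w \<in> \<Lambda> \<longleftrightarrow> (\<exists>m n. Re w = 2 * of_int m * Re (omega1 t) \<and> Im w = 2 * of_int n * Im (omega2 t))"
  unfolding period_lattice_def
  by (auto simp: complex_eq_iff Im_omega1 Re_omega2 mult_ac)

lemma omega_in_lattice: "2 * omega1 t \<in> \<Lambda>" "2 * omega2 t \<in> \<Lambda>" "2 * omega3 t \<in> \<Lambda>"
  unfolding period_lattice_def
  by (auto simp: omega3_def algebra_simps intro: exI[of _ 0] exI[of _ 1])

lemma cnj_lattice: "cnj ` \<Lambda> = \<Lambda>"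
proof -
  have "cnj w \<in> \<Lambda>" if "w \<in> \<Lambda>" for w
    using that unfolding lattice_iff cnj.sel by (metis mult_minus_left mult_minus_right of_int_minus)
  thus ?thesis by (force simp: image_iff intro: bexI[of _ "cnj _"])
qed

text \<open>The shift places the rectangle with its corners at lattice points. One coordinate
  strictly between 0 and its period excludes the lattice, which covers the interior and the open
  sides alike.\<close>

lemma E_plus_omega3_notin_lattice:
  assumes "\<bar>Re (E z)\<bar> < Re (omega1 t) \<or> \<bar>Im (E z)\<bar> < Im (omega2 t)"
  shows "E z + omega3 t \<notin> \<Lambda>"
proof
  have no: False if "\<bar>x\<bar> < y" "x + y = 2 * of_int m * y" for x y :: real and m :: int
  proof -
    have "0 < 2 * of_int m * y" "2 * of_int m * y < 2 * y" "y > 0" using that by linarith+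
    hence "0 < real_of_int m" "real_of_int m < 1" by (auto simp: zero_less_mult_iff)
    thus False by simp
  qed
  assume "E z + omega3 t \<in> \<Lambda>"
  thus False using assms no unfolding lattice_iff by (auto simp: Re_omega3 Im_omega3)
qed

lemma E_corner_in_lattice:
  assumes "Q p = 0"
  shows "E p + omega3 t \<in> \<Lambda>"
proof -
  have c: "cnj (omega3 t) = omega1 t - omega2 t"
    by (simp add: complex_eq_iff omega3_def Im_omega1 Re_omega2)
  have "E p \<in> {omega3 t, - omega3 t, omega1 t - omega2 t, - (omega1 t - omega2 t)}"
    using assms unfolding quartic_eq_0_iff prevertices_def
    by (auto simp: elliptic_E_uminus E_cis_t E_cis_minus_t c simp del: cis_cnj)
  thus ?thesis using omega_in_lattice by (auto simp: omega3_def)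
qed

definition F :: "complex \<Rightarrow> complex" where "F z = wp (E z + omega3 t)"

lemma F_uminus: "F (- z) = F z"
proof -
  have "F (- z) = wp (- (E z - omega3 t))" by (simp add: F_def elliptic_E_uminus)
  also have "\<dots> = wp (E z - omega3 t)" by (rule weierstrass_p_uminus)
  also have "\<dots> = wp (E z - omega3 t + 2 * omega3 t)"
    by (rule weierstrass_p_plus_lattice[symmetric]) (rule omega_in_lattice)
  finally show ?thesis by (simp add: F_def add.commute)
qed

text \<open>The hypothesis says that \<open>w\<close> is fixed modulo periods by reflection in a
  horizontal or a vertical line. The function is even, periodic and commutes with
  conjugation.\<close>

lemma Im_wp_eq_0:
  assumes "cnj w - w \<in> \<Lambda> \<or> cnj w + w \<in> \<Lambda>"
  shows "Im (wp w) = 0"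
proof -
  have "cnj (wp w) = wp (cnj w)" by (rule weierstrass_p_cnj[OF cnj_lattice, symmetric])
  also have "\<dots> = wp w"
    using assms
  proof
    assume "cnj w - w \<in> \<Lambda>"
    from weierstrass_p_plus_lattice[OF this, of w] show ?thesis by simp
  next
    assume "cnj w + w \<in> \<Lambda>"
    from weierstrass_p_plus_lattice[OF this, of "- w"] show ?thesis by (simp add: weierstrass_p_uminus)
  qed
  finally show ?thesis by (simp add: complex_eq_iff)
qed

lemma Im_F_sphere:
  assumes "norm z = 1"
  shows "Im (F z) = 0"
  unfolding F_def
proof (rule Im_wp_eq_0)
  have "Re (E z) + Re (omega1 t) = 2 * of_int m * Re (omega1 t) \<Longrightarrow> cnj (E z + omega3 t) + (E z + omega3 t) \<in> \<Lambda>" for m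
    unfolding lattice_iff by (intro exI[of _ "2*m"] exI[of _ 0]) (simp add: Re_omega3)
  \<comment> \<open>The values 0 and 1 are the left and right sides; for the imaginary part below,
    the bottom and top sides.\<close>
  note re = this[of 0] this[of 1]
  have "Im (E z) + Im (omega2 t) = 2 * of_int m * Im (omega2 t) \<Longrightarrow> cnj (E z + omega3 t) - (E z + omega3 t) \<in> \<Lambda>" for m
    unfolding lattice_iff by (intro exI[of _ "-2*m"] exI[of _ 0]) (simp add: Im_omega3)
  note im = this[of 0] this[of 1]
  show "cnj (E z + omega3 t) - (E z + omega3 t) \<in> \<Lambda> \<or> cnj (E z + omega3 t) + (E z + omega3 t) \<in> \<Lambda>"
    using E_sphere[OF assms] re im omega_pos by (elim disjE conjE) (simp_all add: abs_if split: if_splits)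
qed

lemma Im_F_0: "Im (F 0) = 0"
  unfolding F_def
proof (rule Im_wp_eq_0)
  have "cnj (E 0 + omega3 t) + (E 0 + omega3 t) = 2 * omega1 t"
    by (simp add: complex_eq_iff omega3_def Im_omega1 Re_omega2)
  thus "cnj (E 0 + omega3 t) - (E 0 + omega3 t) \<in> \<Lambda> \<or> cnj (E 0 + omega3 t) + (E 0 + omega3 t) \<in> \<Lambda>"
    using omega_in_lattice by simp
qed

lemma open_lattice_complement: "open (- \<Lambda>)"
  using open_minus_lattice[of "{}"] by simp

lemma isCont_wp: "w \<notin> \<Lambda> \<Longrightarrow> isCont wp w"
  using holomorphic_on_imp_continuous_on[OF holomorphic_weierstrass_p] open_lattice_complement
  by (simp add: continuous_on_eq_continuous_at)

lemma holomorphic_F: "F holomorphic_on ball 0 1"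
proof -
  have "wp \<circ> (\<lambda>z. E z + omega3 t) holomorphic_on ball 0 1"
    by (rule holomorphic_on_compose_gen[OF _ holomorphic_weierstrass_p])
       (use E_plus_omega3_notin_lattice E_ball in \<open>auto intro!: holomorphic_intros holomorphic_elliptic_E\<close>)
  thus ?thesis by (simp add: F_def[abs_def] o_def)
qed

lemma isCont_regular_part_0: "isCont regular_part 0"
  using holomorphic_on_imp_continuous_on[OF holomorphic_regular_part] open_minus_lattice[of "{0}"]
  by (simp add: continuous_on_eq_continuous_at)

definition K :: complex where "K = - 4 * of_real (sin (2*t))^2"

lemma K_nz [simp]: "K \<noteq> 0" by (simp add: K_def)

lemma Im_K: "Im K = 0"
  unfolding K_def by (simp flip: of_real_power)

lemma tendsto_E: "p \<in> cball 0 1 \<Longrightarrow> (E \<longlongrightarrow> E p) (at p within cball 0 1)"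
  using continuous_on_elliptic_E[OF sin_2t_nz] by (auto simp: continuous_on_def)

lemma tendsto_quartic: "(Q \<longlongrightarrow> Q p) (at p within A)"
  using continuous_on_quartic[of UNIV "\<lambda>z. z" t]
  by (auto simp: continuous_on_def intro: tendsto_within_subset)

text \<open>A period moves the corner to 0, where only the principal part
  \<open>1 / (E z - E p)^2\<close> can compensate the zero of Q. The regular part and the arbitrary
  constant \<open>a\<close> are annihilated.\<close>

lemma F_tendsto_corner:
  assumes p: "p \<in> cball 0 1" "Q p = 0"
  shows "((\<lambda>z. (F z - a) * Q z / z^2) \<longlongrightarrow> K) (at p within cball 0 1)"
proof -
  have p0: "p \<noteq> 0" using p by auto
  have F: "F z = 1 / (E z - E p)^2 + regular_part (E z - E p)" for z
  proof -
    have "F z = wp ((E z - E p) + (E p + omega3 t))" by (simp add: F_def)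
    also have "\<dots> = wp (E z - E p)" by (rule weierstrass_p_plus_lattice[OF E_corner_in_lattice[OF p(2)]])
    finally show ?thesis by (simp add: weierstrass_p_eq)
  qed
  have "((\<lambda>z. E z - E p) \<longlongrightarrow> 0) (at p within cball 0 1)"
    using tendsto_diff[OF tendsto_E[OF p(1)] tendsto_const[of "E p"]] by simp
  hence R: "((\<lambda>z. regular_part (E z - E p)) \<longlongrightarrow> 0) (at p within cball 0 1)"
    using isCont_tendsto_compose[OF isCont_regular_part_0] by fastforce
  have "((\<lambda>z. Q z / (z^2 * (E z - E p)^2) + (regular_part (E z - E p) - a) * Q z / z^2) \<longlongrightarrow>
      K + (0 - a) * Q p / p^2) (at p within cball 0 1)"
    unfolding K_def using p0 by (intro tendsto_intros E_corner_asymp p R tendsto_quartic) auto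
  moreover have "Q z / (z^2 * (E z - E p)^2) + (regular_part (E z - E p) - a) * Q z / z^2 = (F z - a) * Q z / z^2" for z
    unfolding F by (simp add: algebra_simps diff_divide_distrib add_divide_distrib)
  ultimately show ?thesis by (simp add: p)
qed

text \<open>At a corner this is read off from the nonzero limit of a quotient with numerator
  Q.\<close>

lemma eventually_quartic_nz:
  assumes p: "p \<in> cball 0 1"
  shows "\<forall>\<^sub>F z in at p within cball 0 1. Q z \<noteq> 0"
proof (cases "Q p = 0")
  case True
  from tendsto_imp_eventually_ne[OF E_corner_asymp[OF p True, folded K_def] K_nz] show ?thesis
    by eventually_elim auto
next
  case False
  from tendsto_imp_eventually_ne[OF tendsto_quartic this] show ?thesis .
qed

lemma Im_quartic_over_square:
  assumes "norm z = 1"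
  shows "Im (Q z / z^2) = 0"
proof -
  have "z \<noteq> 0" using assms by auto
  hence z: "z = cis (Arg z)" using assms cis_Arg[of z] by (simp add: sgn_div_norm)
  have "Q z / z^2 = of_real (4 * sin (t + Arg z) * sin (t - Arg z))"
    by (subst (1 2) z) (simp add: quartic_cis Complex.DeMoivre)
  thus ?thesis by (metis Im_complex_of_real)
qed

text \<open>The quotient of \<open>F - F 0\<close> and \<open>z\<^sup>2 / Q\<close> extends continuously to the closed disk and is
  real on the circle, hence constant.\<close>

lemma F_eq:
  assumes z: "z \<in> ball 0 1"
  shows "F z = F 0 + K * z^2 / Q z"
proof -
  obtain G where G: "G holomorphic_on ball 0 1" "\<And>z. z \<in> ball 0 1 \<Longrightarrow> F z = F 0 + z^2 * G z"
    using even_holomorphic_factor[OF holomorphic_F F_uminus] by blast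
  define h where "h = (\<lambda>z. if Q z = 0 then K else (F z - F 0) * Q z / z^2)"
  \<comment> \<open>Two formulas for one function: \<open>G z * Q z\<close> is visibly holomorphic
    at 0, while \<open>h\<close> carries the boundary values, with the limit \<open>K\<close>
    inserted at the corners.\<close>
  define H where "H = (\<lambda>z. if z \<in> ball 0 1 then G z * Q z else h z)"
  have Hh: "H z = h z" if "z \<noteq> 0" for z
    using that quartic_ball_nz[of z t] G(2)[of z] by (simp add: H_def h_def)
  have holH: "H holomorphic_on ball 0 1"
    by (rule holomorphic_transform[of "\<lambda>z. G z * Q z"]) (use G in \<open>auto intro!: holomorphic_intros simp: H_def\<close>)
  have "continuous_on (cball 0 1) H"
    unfolding continuous_on_def
  proof
    fix p :: complex assume p: "p \<in> cball 0 1"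
    show "(H \<longlongrightarrow> H p) (at p within cball 0 1)"
    proof (cases "p \<in> ball 0 1")
      case True
      hence "isCont H p"
        using holomorphic_on_imp_continuous_on[OF holH] by (simp add: continuous_on_eq_continuous_at)
      thus ?thesis by (auto simp: isCont_def intro: tendsto_within_subset)
    next
      case False
      hence p0: "p \<noteq> 0" by auto
      have "((\<lambda>z. (F z - F 0) * Q z / z^2) \<longlongrightarrow> h p) (at p within cball 0 1)"
      proof (cases "Q p = 0")
        case True
        thus ?thesis using F_tendsto_corner[OF p] by (simp add: h_def)
      next
        case nz: False
        have "norm p = 1" using False p by simp
        hence "E p + omega3 t \<notin> \<Lambda>" using E_sphere[of p] nz by (intro E_plus_omega3_notin_lattice) auto
        hence "(F \<longlongrightarrow> F p) (at p within cball 0 1)"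
          unfolding F_def[abs_def] by (intro isCont_tendsto_compose[OF isCont_wp] tendsto_intros tendsto_E p)
        hence "((\<lambda>z. (F z - F 0) * Q z / z^2) \<longlongrightarrow> (F p - F 0) * Q p / p^2) (at p within cball 0 1)"
          using p0 by (intro tendsto_intros tendsto_quartic) auto
        thus ?thesis using nz by (simp add: h_def)
      qed
      moreover have "\<forall>\<^sub>F z in at p within cball 0 1. (F z - F 0) * Q z / z^2 = H z"
      proof -
        have "\<forall>\<^sub>F z in at p within cball 0 1. z \<noteq> 0"
          using tendsto_imp_eventually_ne[OF tendsto_ident_at p0] .
        with eventually_quartic_nz[OF p] show ?thesis
          by eventually_elim (simp add: Hh h_def)
      qed
      ultimately show ?thesis using p0 by (simp add: Hh tendsto_cong)
    qed
  qed
  moreover have "Im (H z) = 0" if z: "norm z = 1" for z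
  proof -
    have "z \<noteq> 0" using z by auto
    have "Im ((F z - F 0) * (Q z / z^2)) = 0"
      using Im_F_sphere[OF z] Im_F_0 Im_quartic_over_square[OF z]
      by (simp del: times_divide_eq_right)
    thus ?thesis using \<open>z \<noteq> 0\<close> by (simp add: Hh h_def Im_K)
  qed
  ultimately obtain k where k: "\<And>z. z \<in> cball 0 1 \<Longrightarrow> H z = k"
    using Im_zero_on_sphere_imp_constant[OF holH] by blast
  \<comment> \<open>A corner is the one place where the value of the constant is already
    known.\<close>
  have "Q (cis t) = 0" by (simp add: quartic_cis)
  hence "k = K" using k[of "cis t"] by (simp add: Hh h_def)
  hence "G z * Q z = K" using k[of z] z by (simp add: H_def)
  hence "G z = K / Q z" using quartic_ball_nz[OF z, of t] by (simp add: field_simps)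
  thus ?thesis using G(2)[OF z] by simp
qed

lemma has_field_derivative_wp:
  assumes "w \<notin> \<Lambda>"
  shows "(wp has_field_derivative (- 2 / w^3 + deriv regular_part w)) (at w)"
proof -
  have w: "w \<noteq> 0" "w \<in> - (\<Lambda> - {0})" using assms by auto
  have "((\<lambda>z. 1 / z^2) has_field_derivative - 2 / w^3) (at w)"
    using w by (auto intro!: derivative_eq_intros simp: divide_simps power2_eq_square power3_eq_cube)
  from DERIV_add[OF this holomorphic_derivI[OF holomorphic_regular_part open_minus_lattice w(2)]]
  show ?thesis by (simp add: weierstrass_p_eq[abs_def])
qed

section \<open>The value at the half period\<close>

text \<open>The expansion of \<open>wp\<close> at 0 has no constant term, so the additive constant
  in \<open>F\<close> is not free. Writing \<open>F = a + K * y\<close> with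
  \<open>y = z^2 / Q z\<close>, the square of the derivative is a cubic in \<open>y\<close>;
  equating the \<open>y^2\<close> coefficients gives
  \<open>16 * c * K^2 = 12 * a * K^2\<close>.\<close>

lemma F_0: "F 0 = 4 * of_real (cos (2*t)) / 3"
proof -
  define c s :: complex where "c = of_real (cos (2*t))" and "s = of_real (sin (2*t))"
  define a where "a = F 0"
  \<comment> \<open>This corner is sent to \<open>- omega3 t\<close>, so the argument
    \<open>w\<close> of \<open>wp\<close> tends to 0 itself and no period shift is needed.\<close>
  define p where "p = - cis t"
  define \<F> where "\<F> = at p within ball 0 1"
  have cs: "c^2 + s^2 = 1" unfolding c_def s_def by (simp flip: of_real_power of_real_add)
  have Qp: "Q p = 0" by (simp add: p_def quartic_cis)
  have p: "p \<in> cball 0 1" by (simp add: p_def)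
  have Ep: "E p = - omega3 t" by (simp add: p_def elliptic_E_uminus E_cis_t)
  have nontriv: "\<F> \<noteq> bot"
    unfolding \<F>_def trivial_limit_within islimpt_ball using p by simp
  have le: "\<F> \<le> at p within cball 0 1" unfolding \<F>_def by (intro at_le) auto
  define w where "w = (\<lambda>z. E z + omega3 t)"
  define P where "P = (\<lambda>z. - 2 / w z^3 + deriv regular_part (w z))"
  define u where "u = (\<lambda>z. Q z / z^2)"
  have w0: "(w \<longlongrightarrow> 0) \<F>"
    using tendsto_add[OF tendsto_mono[OF le tendsto_E[OF p]] tendsto_const[of "omega3 t"]] by (simp add: w_def Ep)
  have u0: "(u \<longlongrightarrow> 0) \<F>"
  proof -
    have "((\<lambda>z. Q z / z^2) \<longlongrightarrow> Q p / p^2) (at p within ball 0 1)"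
      by (intro tendsto_intros tendsto_quartic) (simp add: p_def)
    thus ?thesis by (simp add: u_def \<F>_def Qp)
  qed
  have asymp: "((\<lambda>z. Q z / (z^2 * (w z)^2)) \<longlongrightarrow> K) \<F>"
    using tendsto_mono[OF le E_corner_asymp[OF p Qp, folded K_def]] by (simp add: Ep w_def)
  have ev: "\<forall>\<^sub>F z in \<F>. z \<in> ball 0 1 \<and> z \<noteq> 0"
    unfolding \<F>_def using tendsto_imp_eventually_ne[OF tendsto_ident_at, of p 0 "ball 0 1"]
    by (auto simp: eventually_at_filter p_def elim: eventually_mono)
  have w_notin: "w z \<notin> \<Lambda>" if "z \<in> ball 0 1" for z
    unfolding w_def using E_ball[OF that] by (intro E_plus_omega3_notin_lattice) auto
  have Fz: "F z = a + K * z^2 / Q z" if "z \<in> ball 0 1" for z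
    unfolding a_def by (rule F_eq[OF that])
  \<comment> \<open>\<open>P z\<close> is the derivative of \<open>wp\<close> at \<open>w z\<close>.
    The formula for \<open>F\<close> is differentiated in \<open>z\<close>, and squaring removes the
    root contributed by the derivative of \<open>E\<close>.\<close>
  have Pz: "P z^2 = 4 * K^2 * z^2 * (1 - z^4)^2 / Q z ^ 3" if z: "z \<in> ball 0 1" for z
  proof -
    have Qz: "Q z \<noteq> 0" using quartic_ball_nz[OF z] .
    have "((\<lambda>z. wp (w z)) has_field_derivative P z * (1 / csqrt (Q z))) (at z)"
      unfolding P_def w_def
      by (rule DERIV_chain2[OF has_field_derivative_wp])
         (use w_notin[OF z] z in \<open>auto intro!: derivative_eq_intros has_field_derivative_elliptic_E simp: w_def\<close>)
    moreover have "((\<lambda>z. a + K * z^2 / Q z) has_field_derivative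
       2 * K * z * (1 - z^4) / Q z^2) (at z)"
    proof -
      have "2 * z * Q z - z^2 * (4 * z^3 - 4 * of_real (cos (2*t)) * z) = 2 * z * (1 - z^4)"
        by (simp add: quartic_def algebra_simps power2_eq_square power3_eq_cube power4_eq_xxxx)
      hence "(K * (2 * z) * Q z - K * z^2 * (4 * z^3 - 4 * of_real (cos (2*t)) * z)) / (Q z * Q z) = 2 * K * z * (1 - z^4) / Q z^2"
        by (simp only: power2_eq_square[of "Q z"]) algebra
      moreover have "((\<lambda>z. a + K * z^2 / Q z) has_field_derivative
        (K * (2 * z) * Q z - K * z^2 * (4 * z^3 - 4 * of_real (cos (2*t)) * z)) / (Q z * Q z)) (at z)"
        using Qz by (auto intro!: derivative_eq_intros)
      ultimately show ?thesis by simp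
    qed
    hence "((\<lambda>z. wp (w z)) has_field_derivative 2 * K * z * (1 - z^4) / Q z^2) (at z)"
      by (rule has_field_derivative_transform_within_open[of _ _ _ "ball 0 1"]) (use Fz z in \<open>auto simp: F_def w_def\<close>)
    ultimately have "P z * (1 / csqrt (Q z)) = 2 * K * z * (1 - z^4) / Q z^2"
      by (rule DERIV_unique)
    hence "P z = 2 * K * z * (1 - z^4) / Q z^2 * csqrt (Q z)" using Qz by (simp add: field_simps)
    hence "P z^2 = (2 * K * z * (1 - z^4) / Q z^2)^2 * Q z" by (simp only: power_mult_distrib power2_csqrt)
    also have "\<dots> = 4 * K^2 * z^2 * (1 - z^4)^2 / Q z ^ 3"
      using Qz by (simp add: field_simps power2_eq_square power3_eq_cube)
    finally show ?thesis .
  qed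
  have r: "((\<lambda>z. regular_part (w z)) \<longlongrightarrow> 0) \<F>"
    using isCont_tendsto_compose[OF isCont_regular_part_0 w0] by simp
  have r': "((\<lambda>z. deriv regular_part (w z)) \<longlongrightarrow> deriv regular_part 0) \<F>"
  proof -
    have "deriv regular_part holomorphic_on - (\<Lambda> - {0})"
      by (intro holomorphic_deriv holomorphic_regular_part open_minus_lattice)
    hence "isCont (deriv regular_part) 0"
      using open_minus_lattice[of "{0}"]
      by (metis Compl_iff Diff_iff continuous_on_eq_continuous_at holomorphic_on_imp_continuous_on insertI1)
    from isCont_tendsto_compose[OF this w0] show ?thesis .
  qed
  have wne: "w z \<noteq> 0" if "z \<in> ball 0 1" for z using w_notin[OF that] by (metis lattice_0)
  \<comment> \<open>This is \<open>w^4 * (P^2 - 4 * F^3)\<close> expanded with F = 1 / w^2 + r and P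
    = - 2 / w^3 + r', where r is the regular part. The terms of order \<open>w^(-6)\<close> have
    cancelled, and each remaining term contains \<open>w\<close> or r, both of which tend to
    0.\<close>
  have "((\<lambda>z. - 4 * w z * deriv regular_part (w z) + w z^4 * (deriv regular_part (w z))^2
      - 12 * regular_part (w z) - 12 * w z^2 * (regular_part (w z))^2 - 4 * w z^4 * (regular_part (w z))^3) \<longlongrightarrow>
      - 4 * 0 * deriv regular_part 0 + 0^4 * (deriv regular_part 0)^2 - 12 * 0 - 12 * 0^2 * 0^2 - 4 * 0^4 * 0^3) \<F>"
    by (intro tendsto_intros w0 r r')
  moreover have "- 4 * w z * deriv regular_part (w z) + w z^4 * (deriv regular_part (w z))^2
      - 12 * regular_part (w z) - 12 * w z^2 * (regular_part (w z))^2 - 4 * w z^4 * (regular_part (w z))^3 =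
      w z^4 * (P z^2 - 4 * (F z)^3)" if "z \<in> ball 0 1" for z
  proof -
    define i where "i = 1 / w z"
    have i: "w z * i = 1" using wne[OF that] by (simp add: i_def)
    have FP: "F z = i^2 + regular_part (w z)" "P z = - 2 * i^3 + deriv regular_part (w z)"
      unfolding F_def P_def i_def weierstrass_p_eq w_def
      by (simp_all add: power_one_over)
    show ?thesis unfolding FP using i by algebra
  qed
  hence "\<forall>\<^sub>F z in \<F>. - 4 * w z * deriv regular_part (w z) + w z^4 * (deriv regular_part (w z))^2
      - 12 * regular_part (w z) - 12 * w z^2 * (regular_part (w z))^2 - 4 * w z^4 * (regular_part (w z))^3 =
      w z^4 * (P z^2 - 4 * (F z)^3)"
    using ev by (auto elim: eventually_mono)
  ultimately have "((\<lambda>z. w z^4 * (P z^2 - 4 * (F z)^3)) \<longlongrightarrow> 0) \<F>"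
    by (simp add: tendsto_cong)
  \<comment> \<open>The squared quotient tends to \<open>K^2\<close> and trades \<open>w^4\<close>
    for \<open>u^2\<close>. In y = 1 / u the cubic terms of P^2 and 4 F^3 agree, so after
    multiplication by \<open>u^2\<close> a polynomial in \<open>u\<close> remains whose constant
    term is the difference of the \<open>y^2\<close> coefficients.\<close>
  from tendsto_mult[OF this tendsto_power[OF asymp, of 2]]
  have 1: "((\<lambda>z. w z^4 * (P z^2 - 4 * (F z)^3) * (Q z / (z^2 * (w z)^2))^2) \<longlongrightarrow> 0) \<F>"
    by simp
  have "((\<lambda>z. K^2 * (16 * c - 12 * a) + (4 * K^2 - 12 * a^2 * K) * u z - 4 * a^3 * (u z)^2) \<longlongrightarrow>
      K^2 * (16 * c - 12 * a) + (4 * K^2 - 12 * a^2 * K) * 0 - 4 * a^3 * 0^2) \<F>"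
    by (intro tendsto_intros u0)
  moreover have "K^2 * (16 * c - 12 * a) + (4 * K^2 - 12 * a^2 * K) * u z - 4 * a^3 * (u z)^2 =
     w z^4 * (P z^2 - 4 * (F z)^3) * (Q z / (z^2 * (w z)^2))^2" if z: "z \<in> ball 0 1" "z \<noteq> 0" for z
  proof -
    have Qz: "Q z \<noteq> 0" using quartic_ball_nz[OF z(1)] .
    \<comment> \<open>Expand \<open>(1 + z^4)^2 - 4 * z^4\<close> with
      \<open>1 + z^4 = Q z + 2 * c * z^2\<close>; the leftover \<open>4 * (c^2 - 1) * z^4\<close> is
      \<open>K * z^4\<close>.\<close>
    have "(1 - z^4)^2 = K * z^4 + 4 * c * z^2 * Q z + Q z^2"
      using cs unfolding quartic_def K_def c_def[symmetric] s_def[symmetric] by algebra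
    hence "P z^2 = 4 * K^2 * z^2 * (K * z^4 + 4 * c * z^2 * Q z + Q z^2) / Q z^3"
      using Pz[OF z(1)] by simp
    also have "\<dots> = 4 * K^2 * (K * (z^2 / Q z)^3 + 4 * c * (z^2 / Q z)^2 + z^2 / Q z)"
      using Qz by (simp add: field_simps power2_eq_square power3_eq_cube power4_eq_xxxx)
    finally have P: "P z^2 = 4 * K^2 * (K * (z^2 / Q z)^3 + 4 * c * (z^2 / Q z)^2 + z^2 / Q z)" .
    have "w z^4 * (P z^2 - 4 * (F z)^3) * (Q z / (z^2 * (w z)^2))^2 = (P z^2 - 4 * (F z)^3) * (u z)^2"
      using wne[OF z(1)] by (simp add: u_def power_divide power_mult_distrib)
    also have "\<dots> = K^2 * (16 * c - 12 * a) + (4 * K^2 - 12 * a^2 * K) * u z - 4 * a^3 * (u z)^2"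
    proof -
      define y where "y = z^2 / Q z"
      have uy: "u z * y = 1" using Qz z by (simp add: u_def y_def)
      have Fy: "F z = a + K * y" using Fz[OF z(1)] by (simp add: y_def)
      show ?thesis unfolding P Fy y_def[symmetric] using uy by algebra
    qed
    finally show ?thesis by simp
  qed
  hence "\<forall>\<^sub>F z in \<F>. K^2 * (16 * c - 12 * a) + (4 * K^2 - 12 * a^2 * K) * u z - 4 * a^3 * (u z)^2 =
     w z^4 * (P z^2 - 4 * (F z)^3) * (Q z / (z^2 * (w z)^2))^2"
    using ev by (auto elim: eventually_mono)
  ultimately have "((\<lambda>z. w z^4 * (P z^2 - 4 * (F z)^3) * (Q z / (z^2 * (w z)^2))^2) \<longlongrightarrow> K^2 * (16 * c - 12 * a)) \<F>"
    by (simp add: tendsto_cong)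
  from tendsto_unique[OF nontriv this 1] have "16 * c - 12 * a = 0" by simp
  hence "a = 4 * c / 3" by (simp add: field_simps)
  thus ?thesis by (simp add: a_def c_def)
qed

theorem weierstrass_p_elliptic_E:
  assumes "z \<in> ball 0 1"
  shows "wp (E z + omega3 t) = 4 * of_real (cos (2*t)) / 3 - 4 * of_real (sin (2*t))^2 * z^2 / Q z"
  using F_eq[OF assms] unfolding F_0 by (simp add: F_def K_def)

end

subsection \<open>The Schwarzian derivative\<close>

lemma deriv_eqI_open:
  assumes "(f has_field_derivative f') (at z)" "open S" "z \<in> S" "\<And>w. w \<in> S \<Longrightarrow> f w = g w"
  shows "deriv g z = f'"
  by (rule DERIV_imp_deriv, rule has_field_derivative_transform_within_open[OF assms(1-3)]) (use assms in auto)

text \<open>The cocycle rule. Agreement of \<open>f\<close> with the composite is assumed only on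
  the open set \<open>S\<close>, which suffices for all the derivatives involved.\<close>

lemma schwarzian_compose:
  assumes S: "open S" and T: "open T" and h: "h holomorphic_on S" "h ` S \<subseteq> T" and g: "g holomorphic_on T"
    and f: "\<And>w. w \<in> S \<Longrightarrow> f w = g (h w)"
    and h': "\<And>w. w \<in> S \<Longrightarrow> deriv h w \<noteq> 0" and g': "\<And>w. w \<in> T \<Longrightarrow> deriv g w \<noteq> 0"
    and z: "z \<in> S"
  shows "schwarzian f z = schwarzian g (h z) * (deriv h z)^2 + schwarzian h z"
proof -
  note [holomorphic_intros] = holomorphic_deriv[OF _ S] holomorphic_deriv[OF _ T]
  have hT: "h w \<in> T" if "w \<in> S" for w using h(2) that by blast
  define P where "P = (\<lambda>w. deriv (deriv g) w / deriv g w)"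
  define R where "R = (\<lambda>w. deriv (deriv h) w / deriv h w)"
  have P: "P holomorphic_on T" unfolding P_def by (intro holomorphic_intros g g')
  have R: "R holomorphic_on S" unfolding R_def by (intro holomorphic_intros h h')
  note DS = holomorphic_derivI[OF _ S] and DT = holomorphic_derivI[OF _ T]
  have f1: "deriv f w = deriv g (h w) * deriv h w" if w: "w \<in> S" for w
    by (rule deriv_eqI_open[OF DERIV_chain2[where f = g and g = h] S w])
       (use DS[OF h(1) w] DT[OF g hT[OF w]] f in auto)
  have f2: "deriv (deriv f) w = (deriv (deriv g) (h w) * deriv h w) * deriv h w + deriv (deriv h) w * deriv g (h w)"
    if w: "w \<in> S" for w
  proof (rule deriv_eqI_open[OF _ S w])
    show "((\<lambda>w. deriv g (h w) * deriv h w) has_field_derivative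
       (deriv (deriv g) (h w) * deriv h w) * deriv h w + deriv (deriv h) w * deriv g (h w)) (at w)"
      by (intro DERIV_mult DERIV_chain2[where f = "deriv g" and g = h] DS[OF h(1) w]
          DS[OF holomorphic_deriv[OF h(1) S] w] DT[OF holomorphic_deriv[OF g T] hT[OF w]])
  qed (simp add: f1)
  have N: "deriv (deriv f) w / deriv f w = P (h w) * deriv h w + R w" if w: "w \<in> S" for w
    unfolding f2[OF w] f1[OF w] P_def R_def using h'[OF w] g'[OF hT[OF w]] by (simp add: field_simps)
  have "deriv (\<lambda>w. deriv (deriv f) w / deriv f w) z =
      (deriv P (h z) * deriv h z) * deriv h z + deriv (deriv h) z * P (h z) + deriv R z"
  proof (rule deriv_eqI_open[OF _ S z])
    show "((\<lambda>w. P (h w) * deriv h w + R w) has_field_derivative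
        (deriv P (h z) * deriv h z) * deriv h z + deriv (deriv h) z * P (h z) + deriv R z) (at z)"
      by (intro DERIV_add DERIV_mult DERIV_chain2[where f = P and g = h] DS[OF h(1) z]
          DS[OF holomorphic_deriv[OF h(1) S] z] DS[OF R z] DT[OF P hT[OF z]])
  qed (simp add: N)
  \<comment> \<open>This makes the mixed term of the square cancel the term with the second
    derivative of \<open>h\<close>.\<close>
  moreover have "deriv (deriv h) z = R z * deriv h z" using h'[OF z] by (simp add: R_def)
  moreover have sg: "schwarzian g (h z) = deriv P (h z) - 1 / 2 * P (h z) ^ 2"
    "schwarzian h z = deriv R z - 1 / 2 * R z ^ 2"
    by (simp_all only: schwarzian_def P_def R_def)
  ultimately show ?thesis
    unfolding schwarzian_def[of f] N[OF z] sg by (simp add: algebra_simps power2_eq_square)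
qed

text \<open>Since E' = Q^(-1/2), the logarithmic derivative of E' is - Q' / (2 Q), a rational
  function; the 3/8 is 1/2 - 1/8.\<close>

lemma schwarzian_elliptic_E:
  fixes t :: real
  assumes z: "z \<in> ball 0 1"
  defines "c \<equiv> complex_of_real (cos (2*t))"
  shows "schwarzian (elliptic_E t) z =
     - (12 * z^2 - 4 * c) / (2 * quartic t z) + 3 * (4 * z^3 - 4 * c * z)^2 / (8 * quartic t z ^ 2)"
proof -
  let ?E = "elliptic_E t" and ?Q = "quartic t"
  have nz: "?Q w \<noteq> 0" if "w \<in> ball 0 1" for w using quartic_ball_nz[OF that] .
  have E1: "deriv ?E w = 1 / csqrt (?Q w)" if "w \<in> ball 0 1" for w
    by (rule DERIV_imp_deriv[OF has_field_derivative_elliptic_E[OF that]])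
  have E2: "deriv (deriv ?E) w = - (4 * w^3 - 4 * c * w) / (2 * csqrt (?Q w)) / ?Q w" if w: "w \<in> ball 0 1" for w
  proof (rule deriv_eqI_open[OF _ _ w])
    define X where "X = 4 * w^3 - 4 * c * w"
    have D: "((\<lambda>w. csqrt (?Q w)) has_field_derivative X / (2 * csqrt (?Q w))) (at w)"
      using quartic_notin_nonpos_Reals[OF w] by (auto intro!: derivative_eq_intros simp: c_def X_def)
    have "csqrt (?Q w) * csqrt (?Q w) = ?Q w" by (simp flip: power2_eq_square)
    thus "((\<lambda>w. 1 / csqrt (?Q w)) has_field_derivative - (4 * w^3 - 4 * c * w) / (2 * csqrt (?Q w)) / ?Q w) (at w)"
      using DERIV_divide[OF DERIV_const[of 1] D] nz[OF w] unfolding X_def[symmetric] by simp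
  qed (simp_all add: E1)
  have N: "deriv (deriv ?E) w / deriv ?E w = - (4 * w^3 - 4 * c * w) / (2 * ?Q w)" if w: "w \<in> ball 0 1" for w
    unfolding E1[OF w] E2[OF w] using nz[OF w] by simp
  have "deriv (\<lambda>w. deriv (deriv ?E) w / deriv ?E w) z =
      (- (12 * z^2 - 4 * c) * (2 * ?Q z) - (- (4 * z^3 - 4 * c * z)) * (2 * (4 * z^3 - 4 * c * z))) / (2 * ?Q z * (2 * ?Q z))"
  proof (rule deriv_eqI_open[OF _ _ z])
    show "((\<lambda>w. - (4 * w^3 - 4 * c * w) / (2 * ?Q w)) has_field_derivative
        (- (12 * z^2 - 4 * c) * (2 * ?Q z) - (- (4 * z^3 - 4 * c * z)) * (2 * (4 * z^3 - 4 * c * z))) / (2 * ?Q z * (2 * ?Q z))) (at z)"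
      by (rule DERIV_divide) (use nz[OF z] in \<open>auto intro!: derivative_eq_intros simp: c_def\<close>)
  qed (simp_all add: N)
  thus ?thesis
    unfolding schwarzian_def N[OF z] using nz[OF z] by (simp add: divide_simps) algebra
qed

text \<open>The chain rule is applied to f = g o E and solved for the Schwarzian of
  \<open>g\<close>, so the Schwarzian of the inverse of E never has to be computed.\<close>

lemma schwarzian_compose_inverse_elliptic_E:
  assumes f: "f holomorphic_on ball 0 1" "inj_on f (ball 0 1)"
    and g: "g = f \<circ> inv_into (ball 0 1) (elliptic_E t)" and z: "z \<in> ball 0 1"
  shows "schwarzian g (elliptic_E t z) =
     (schwarzian f z - schwarzian (elliptic_E t) z) * quartic t z"
proof -
  let ?E = "elliptic_E t"
  have inj: "inj_on ?E (ball 0 1)" by (rule inj_on_elliptic_E)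
  have op: "open (?E ` ball 0 1)"
    by (intro open_mapping_thm3 holomorphic_elliptic_E inj) auto
  obtain h where h: "h holomorphic_on ?E ` ball 0 1" "\<And>z. z \<in> ball 0 1 \<Longrightarrow> h (?E z) = z"
    using holomorphic_has_inverse[OF holomorphic_elliptic_E open_ball inj] by metis
  have gE: "g (?E w) = f w" if "w \<in> ball 0 1" for w
    using that inj by (simp add: g)
  have "f \<circ> h holomorphic_on ?E ` ball 0 1"
    by (rule holomorphic_on_compose_gen[OF h(1) f(1)]) (use h(2) in auto)
  hence holg: "g holomorphic_on ?E ` ball 0 1"
    by (rule holomorphic_transform) (use h(2) gE in auto)
  have injg: "inj_on g (?E ` ball 0 1)"
    using f(2) gE by (auto simp: inj_on_def)
  have E': "deriv ?E w = 1 / csqrt (quartic t w)" if "w \<in> ball 0 1" for w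
    by (rule DERIV_imp_deriv[OF has_field_derivative_elliptic_E[OF that]])
  have "schwarzian f z = schwarzian g (?E z) * (deriv ?E z)^2 + schwarzian ?E z"
  proof (rule schwarzian_compose[OF open_ball op holomorphic_elliptic_E order_refl holg _ _ _ z])
    show "deriv g w \<noteq> 0" if "w \<in> ?E ` ball 0 1" for w
      by (rule holomorphic_injective_imp_regular[OF holg op injg that])
    show "deriv ?E w \<noteq> 0" if "w \<in> ball 0 1" for w
      using quartic_ball_nz[OF that, of t] by (simp add: E'[OF that])
  qed (simp add: gE)
  moreover have "(deriv ?E z)^2 = 1 / quartic t z"
    by (simp add: E'[OF z] power_divide)
  ultimately show ?thesis using quartic_ball_nz[OF z, of t] by (simp add: field_simps)
qed

section \<open>Comparison of the two sides as affine functions of z^2 / Q\<close>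

theorem mainTheorem2:
  fixes \<alpha> t lam :: real and v :: complex and D :: "complex set" and f g :: "complex \<Rightarrow> complex"
  assumes "0 \<le> \<alpha>" "\<alpha> \<le> 2" and "0 < t" "t < pi / 2"
    and "symmetric_circular_quadrilateral D v \<alpha>"
    and "conformal_onto f (ball 0 1) D"
    and "f 0 = 0" and "deriv f 0 \<in> \<real>" "0 < Re (deriv f 0)"
    and "boundary_maps_onto f (prevertices t) (quad_vertices v)"
    and "\<And>z. z \<in> ball 0 1 \<Longrightarrow>
           schwarzian f z =
             4 * (1 - of_real (\<alpha>\<^sup>2))
               * ((of_real (cos (2 * t)) * z ^ 4 - 2 * z ^ 2 + of_real (cos (2 * t)))
                   / (z ^ 4 - 2 * of_real (cos (2 * t)) * z ^ 2 + 1) ^ 2)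
             - 2 * of_real lam
               * (2 * of_real (sin (2 * t)) / (z ^ 4 - 2 * of_real (cos (2 * t)) * z ^ 2 + 1))"
    and "g = f \<circ> inv_into (ball 0 1) (elliptic_E t)"
  shows "\<exists>\<mu>::real.
           (\<forall>\<zeta>\<in>rect_R t. schwarzian g \<zeta> =
              of_real ((1 - 4 * \<alpha>\<^sup>2) / 2)
                * weierstrass_p (2 * omega1 t) (2 * omega2 t) (\<zeta> + omega3 t)
              - 2 * of_real \<mu>) \<and>
           \<mu> = 2 * (\<alpha>\<^sup>2 - 1) / 3 * cos (2 * t) + 2 * lam * sin (2 * t)"
proof (intro exI conjI ballI refl)
  interpret quartic_angle t by unfold_locales (use assms in auto)
  define c s A L :: complex where "c = of_real (cos (2*t))" and "s = of_real (sin (2*t))"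
    and "A = of_real \<alpha> ^ 2" and "L = of_real lam"
  have cs: "c^2 + s^2 = 1" unfolding c_def s_def by (simp flip: of_real_power of_real_add)
  fix \<zeta> assume "\<zeta> \<in> rect_R t"
  then obtain z where z: "z \<in> ball 0 1" "\<zeta> = E z" by (auto simp: rect_R_def)
  define q where "q = Q z"
  have q: "q \<noteq> 0" unfolding q_def using quartic_ball_nz[OF z(1)] .
  have q_eq: "q = z^4 - 2 * c * z^2 + 1" by (simp add: q_def quartic_def c_def)
  have Sf: "schwarzian f z = 4 * (1 - A) * ((c * z^4 - 2 * z^2 + c) / q^2) - 2 * L * (2 * s / q)"
    using assms(11)[OF z(1)] unfolding q_eq by (simp add: c_def s_def A_def L_def)
  have "schwarzian g \<zeta> = (schwarzian f z - schwarzian E z) * q"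
    unfolding z(2) q_def
    using schwarzian_compose_inverse_elliptic_E[OF _ _ assms(12) z(1)] assms(6) by (simp add: conformal_onto_def)
  also have "\<dots> = 4 * (1 - A) * (c * z^4 - 2 * z^2 + c) / q - 4 * L * s
      + (12 * z^2 - 4 * c) / 2 - 3 * (4 * z^3 - 4 * c * z)^2 / (8 * q)"
    unfolding Sf schwarzian_elliptic_E[OF z(1)] c_def[symmetric] q_def[symmetric]
    using q by (simp add: field_simps power2_eq_square)
  also have "\<dots> = (1 - 4 * A) / 2 * (4 * c / 3 - 4 * s^2 * z^2 / q)
      - 2 * (2 * (A - 1) / 3 * c + 2 * L * s)"
  proof -
    \<comment> \<open>Reduction modulo Q: the double pole in S_f loses one order to the factor Q,
      and the rest is affine in \<open>z^2 / q\<close>.\<close>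
    have "c * z^4 - 2 * z^2 + c = c * q - 2 * s^2 * z^2"
      using q_eq cs by algebra
    hence 1: "(c * z^4 - 2 * z^2 + c) / q = c - 2 * s^2 * (z^2 / q)"
      using q by (simp add: diff_divide_distrib)
    \<comment> \<open>The term \<open>2 * c * q\<close> is subtracted and added so that the first
      bracket is Q'' / 2, which cancels the polynomial part of the Schwarzian of E.\<close>
    have "3 * (4 * z^3 - 4 * c * z)^2 = 8 * ((6 * z^2 - 2 * c) * q - (6 * s^2 * z^2 - 2 * c * q))"
      using q_eq cs by algebra
    hence 2: "3 * (4 * z^3 - 4 * c * z)^2 / (8 * q) = (6 * z^2 - 2 * c) - (6 * s^2 * (z^2 / q) - 2 * c)"
      using q by (simp add: diff_divide_distrib)
    define y where "y = z^2 / q"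
    have 3: "4 * s^2 * z^2 / q = 4 * s^2 * y" by (simp add: y_def)
    show ?thesis
      unfolding 2 3 unfolding times_divide_eq_right[symmetric] 1 y_def[symmetric] by (simp add: field_simps)
  qed
  also have "4 * c / 3 - 4 * s^2 * z^2 / q = wp (\<zeta> + omega3 t)"
    unfolding z(2) weierstrass_p_elliptic_E[OF z(1)] by (simp add: c_def s_def q_def)
  finally show "schwarzian g \<zeta> = of_real ((1 - 4 * \<alpha>\<^sup>2) / 2) * wp (\<zeta> + omega3 t)
      - 2 * of_real (2 * (\<alpha>\<^sup>2 - 1) / 3 * cos (2 * t) + 2 * lam * sin (2 * t))"
    by (simp add: c_def s_def A_def L_def)
qed (rule refl)

end
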